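(* For an odd prime $p$ and positive integers $t,s$ with $p\nmid s$, put $r=p^t$, $q=r^s$, let $\eta$ be the quadratic multiplicative character of $\mathbb{F}_r$ (with $\eta(0)=0$), $D=\{x\in\mathbb{F}_q^*:\eta(\mathrm{Tr}_{q/r}(x+1))=-\eta(s)\}$ (with $s$ regarded as an element of $\mathbb{F}_p\subseteq\mathbb{F}_r$), $K=\#D$, $E$ the set of all $N=q-1$ multiplicative characters of $\mathbb{F}_q^*$, and $\mathcal{C}(D;E)=\{\mathbf{c}_\varphi=\frac{1}{\sqrt K}(\varphi(x))_{x\in D}:\varphi\in E\}$. Let $I_{max}(\mathcal{C}(D;E))=\max_{\varphi\neq\varphi'}|\mathbf{c}_\varphi\mathbf{c}_{\varphi'}^H|$ and let $I_W=\sqrt{\frac{N-K}{(N-1)K}}$ be the Welch bound. Then $\frac{I_{max}(\mathcal{C}(D;E))}{I_W}\to 1$ as $r\to\infty$; that is, for every sequence of such parameter triples $(p,t,s)$ for which $r=p^t\to\infty$, the ratio $I_{max}(\mathcal{C}(D;E))/I_W$ tends to $1$.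
   Context: $\mathrm{Tr}_{q/r}$ denotes the trace map from $\mathbb{F}_q$ to $\mathbb{F}_r$; $\mathbf{c}^H$ is the conjugate transpose. A multiplicative character of $\mathbb{F}_q^*$ is a group homomorphism $\mathbb{F}_q^*\to\mathbb{C}^*$. *)

theory Defs
  imports "HOL-Analysis.Analysis" "HOL-Algebra.Algebra"
begin

text \<open>Finite fields are modelled as HOL-Algebra fields F with finite carrier.
  The subfield F_r of F (r = p^t) is the set of fixed points of x |-> x^r.\<close>

definition subfield_r :: "('a, 'b) ring_scheme \<Rightarrow> nat \<Rightarrow> 'a set" where
  "subfield_r F r = {y \<in> carrier F. y [^]\<^bsub>F\<^esub> r = y}"

definition trace_qr :: "('a, 'b) ring_scheme \<Rightarrow> nat \<Rightarrow> nat \<Rightarrow> 'a \<Rightarrow> 'a" where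
  "trace_qr F r s x = (\<Oplus>\<^bsub>F\<^esub> i \<in> {..<s}. x [^]\<^bsub>F\<^esub> (r ^ i))"

definition quad_char_r :: "('a, 'b) ring_scheme \<Rightarrow> nat \<Rightarrow> 'a \<Rightarrow> real" where
  "quad_char_r F r y =
     (if y = \<zero>\<^bsub>F\<^esub> then 0
      else if (\<exists>z \<in> subfield_r F r. z \<otimes>\<^bsub>F\<^esub> z = y) then 1 else -1)"

definition Dset :: "('a, 'b) ring_scheme \<Rightarrow> nat \<Rightarrow> nat \<Rightarrow> 'a set" where
  "Dset F r s = {x \<in> carrier F - {\<zero>\<^bsub>F\<^esub>}.
      quad_char_r F r (trace_qr F r s (x \<oplus>\<^bsub>F\<^esub> \<one>\<^bsub>F\<^esub>))
        = - quad_char_r F r ([s] \<cdot>\<^bsub>F\<^esub> \<one>\<^bsub>F\<^esub>)}"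

text \<open>Multiplicative characters of F^*: group homomorphisms F^* -> C^*,
  extended by 0 outside F^* (so that they are determined as functions).\<close>
definition mult_chars :: "('a, 'b) ring_scheme \<Rightarrow> ('a \<Rightarrow> complex) set" where
  "mult_chars F = {\<phi>. (\<forall>x \<in> carrier F - {\<zero>\<^bsub>F\<^esub>}. \<phi> x \<noteq> 0)
      \<and> (\<forall>x \<in> carrier F - {\<zero>\<^bsub>F\<^esub>}. \<forall>y \<in> carrier F - {\<zero>\<^bsub>F\<^esub>}.
            \<phi> (x \<otimes>\<^bsub>F\<^esub> y) = \<phi> x * \<phi> y)
      \<and> (\<forall>x. x \<notin> carrier F - {\<zero>\<^bsub>F\<^esub>} \<longrightarrow> \<phi> x = 0)}"

definition codeword :: "'a set \<Rightarrow> ('a \<Rightarrow> complex) \<Rightarrow> 'a \<Rightarrow> complex" where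
  "codeword D \<phi> x = \<phi> x / complex_of_real (sqrt (real (card D)))"

definition code_inner :: "'a set \<Rightarrow> ('a \<Rightarrow> complex) \<Rightarrow> ('a \<Rightarrow> complex) \<Rightarrow> complex" where
  "code_inner D \<phi> \<psi> = (\<Sum>x \<in> D. codeword D \<phi> x * cnj (codeword D \<psi> x))"

definition I_max :: "'a set \<Rightarrow> ('a \<Rightarrow> complex) set \<Rightarrow> real" where
  "I_max D E = Max {cmod (code_inner D \<phi> \<psi>) | \<phi> \<psi>. \<phi> \<in> E \<and> \<psi> \<in> E \<and> \<phi> \<noteq> \<psi>}"

definition welch_bound :: "nat \<Rightarrow> nat \<Rightarrow> real" where
  "welch_bound N K = sqrt ((real N - real K) / ((real N - 1) * real K))"

end

theory Submission
  imports Defs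
begin

text \<open>
  Write \<open>\<xi> = \<phi> cnj \<psi>\<close> for two distinct characters; \<open>\<xi>\<close> is nontrivial. With \<open>\<sigma> = Tr 1 = s\<close> the
  indicator of \<open>D\<close> at \<open>x\<close> is \<open>(1 - [Tr x = -\<sigma>] - \<eta>(\<sigma>) \<eta>(Tr x + \<sigma>)) / 2\<close>, so twice the sum of \<open>\<xi>\<close> over
  \<open>D\<close> is \<open>- A(-\<sigma>) - \<eta>(\<sigma>) V(\<sigma>)\<close>, where \<open>A(y)\<close> is the sum of \<open>\<xi>\<close> over the fibre \<open>Tr x = y\<close> and \<open>V(c)\<close> is the
  sum of \<open>\<xi>(x) \<eta>(Tr x + c)\<close>. Substituting \<open>c x\<close> for \<open>x\<close> shows that \<open>|A|\<close> and \<open>|V|\<close> are constant on the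
  nonzero elements of the subfield. The second moments over the subfield are \<open>q - q/r\<close> for \<open>A\<close> and
  \<open>q (r - 1)\<close> for \<open>V\<close>; the latter uses that distinct translates of \<open>\<eta>\<close> have correlation \<open>-1\<close>. Hence
  \<open>|A(-\<sigma>)| \<le> sqrt (q/r)\<close> and \<open>|V(\<sigma>)| \<le> sqrt q\<close>, and as \<open>K = q (r - 1) / (2 r)\<close>, the maximal
  correlation is at most \<open>1 / (sqrt q (1 - 1 / sqrt r))\<close>. Parseval over all characters shows that it is
  at least the Welch bound, which in turn is at least \<open>1 / sqrt q\<close>.
\<close>

section \<open>Binomial expansion and additivity of the p-th power in a commutative ring\<close>

lemma (in cring) binomial_expansion:
  fixes n :: nat
  assumes x: "x \<in> carrier R" and y: "y \<in> carrier R"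
  shows "(x \<oplus> y) [^] n = (\<Oplus>k\<in>{..n}. [(n choose k)] \<cdot> (x [^] k \<otimes> y [^] (n - k)))"
proof (induction n)
  case 0
  show ?case using x y by simp
next
  case (Suc n)
  define f where "f m k = [(m choose k)] \<cdot> (x [^] k \<otimes> y [^] (m - k))" for m k
  \<comment> \<open>\<open>g\<close> is the share of Pascal's rule that comes from multiplying by
    \<open>y\<close>. Its term at \<open>Suc n\<close> has binomial coefficient 0, so the index of
    its sum can be shifted by one.\<close>
  define g where "g k = [(n choose k)] \<cdot> (x [^] k \<otimes> y [^] (Suc n - k))" for k
  have fc: "f m k \<in> carrier R" for m k using x y by (simp add: f_def)
  have gc: "g k \<in> carrier R" for k using x y by (simp add: g_def)
  have split: "f (Suc n) (Suc k) = f n k \<otimes> x \<oplus> g (Suc k)" for k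
  proof -
    have a: "f n k \<otimes> x = [(n choose k)] \<cdot> (x [^] Suc k \<otimes> y [^] (n - k))"
      using x y unfolding f_def by (simp add: add_pow_ldistr add_pow_rdistr m_ac)
    show ?thesis
      unfolding a unfolding f_def g_def using x y
      by (simp add: add.nat_pow_mult)
  qed
  have gy: "f n k \<otimes> y = g k" if "k \<le> n" for k
    using x y that unfolding f_def g_def by (simp add: add_pow_ldistr add_pow_rdistr m_ac Suc_diff_le)
  have g_last: "g (Suc n) = \<zero>" unfolding g_def by (simp add: binomial_eq_0 del: nat_pow_Suc)
  have g_sum: "finsum R g {..n} = finsum R (\<lambda>k. g (Suc k)) {..n} \<oplus> g 0"
  proof -
    have "finsum R g {..Suc n} = finsum R g {..n}"
      using gc g_last by (simp add: finsum_Suc)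
    moreover have "finsum R g {..Suc n} = finsum R (\<lambda>k. g (Suc k)) {..n} \<oplus> g 0"
      using gc by (intro finsum_Suc2) auto
    ultimately show ?thesis by simp
  qed
  have "(x \<oplus> y) [^] Suc n = finsum R (f n) {..n} \<otimes> (x \<oplus> y)"
    unfolding nat_pow_Suc Suc f_def by (rule refl)
  also have "\<dots> = finsum R (f n) {..n} \<otimes> x \<oplus> finsum R (f n) {..n} \<otimes> y"
    using x y fc by (simp add: r_distr)
  also have "\<dots> = finsum R (\<lambda>k. f n k \<otimes> x) {..n} \<oplus> finsum R (\<lambda>k. f n k \<otimes> y) {..n}"
    using x y fc by (simp add: finsum_ldistr)
  also have "finsum R (\<lambda>k. f n k \<otimes> y) {..n} = finsum R g {..n}"
    using gy gc by (intro finsum_cong') auto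
  also have "\<dots> = finsum R (\<lambda>k. g (Suc k)) {..n} \<oplus> g 0" by (fact g_sum)
  also have "finsum R (\<lambda>k. f n k \<otimes> x) {..n} \<oplus> (finsum R (\<lambda>k. g (Suc k)) {..n} \<oplus> g 0) =
      finsum R (\<lambda>k. f n k \<otimes> x) {..n} \<oplus> finsum R (\<lambda>k. g (Suc k)) {..n} \<oplus> g 0"
    using x fc gc by (simp add: a_assoc)
  also have "finsum R (\<lambda>k. f n k \<otimes> x) {..n} \<oplus> finsum R (\<lambda>k. g (Suc k)) {..n}
      = finsum R (\<lambda>k. f (Suc n) (Suc k)) {..n}"
    using x fc gc by (simp add: split finsum_addf)
  also have "g 0 = f (Suc n) 0" using x y by (simp add: f_def g_def)
  also have "finsum R (\<lambda>k. f (Suc n) (Suc k)) {..n} \<oplus> f (Suc n) 0 = finsum R (f (Suc n)) {..Suc n}"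
    using fc by (intro finsum_Suc2[symmetric]) auto
  finally show ?case unfolding f_def .
qed

text \<open>The prime p divides every binomial coefficient with 0 < k < p, and p annihilates the
  ring, so only the two end terms of the expansion survive.\<close>

lemma (in cring) frobenius_add:
  fixes p :: nat
  assumes p: "Factorial_Ring.prime p" and char: "[p] \<cdot> \<one> = \<zero>"
    and x: "x \<in> carrier R" and y: "y \<in> carrier R"
  shows "(x \<oplus> y) [^] p = x [^] p \<oplus> y [^] p"
proof -
  define f where "f k = [(p choose k)] \<cdot> (x [^] k \<otimes> y [^] (p - k))" for k
  have fc: "f k \<in> carrier R" for k using x y by (simp add: f_def)
  have ann: "[p] \<cdot> z = \<zero>" if "z \<in> carrier R" for z
    using add_pow_ldistr[of \<one> z p] char that by simp
  have mid: "f k = \<zero>" if "0 < k" "k < p" for k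
  proof -
    have "p dvd p choose k" using that p by (intro dvd_choose_prime) auto
    then obtain m where "p choose k = p * m" by blast
    then have "f k = [p] \<cdot> ([m] \<cdot> (x [^] k \<otimes> y [^] (p - k)))"
      using x y by (simp add: f_def add.nat_pow_pow mult.commute)
    then show ?thesis using ann x y by simp
  qed
  have p0: "p > 0" using p by (simp add: prime_gt_0_nat)
  have "(x \<oplus> y) [^] p = finsum R f {..p}"
    unfolding f_def by (rule binomial_expansion[OF x y])
  also have "\<dots> = finsum R f {0, p}"
  proof (rule add.finprod_mono_neutral_cong_right)
    show "\<And>k. k \<in> {..p} - {0, p} \<Longrightarrow> f k = \<zero>" using mid by auto
  qed (use fc p0 in auto)
  also have "\<dots> = f 0 \<oplus> f p" using fc p0 by (subst finsum_insert) auto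
  also have "\<dots> = x [^] p \<oplus> y [^] p" using x y p0 by (simp add: f_def a_comm)
  finally show ?thesis .
qed

section \<open>The field of q elements and its cyclic multiplicative group\<close>

locale finite_field_trace = field F for F (structure) +
  fixes p t s :: nat
  assumes prime_p: "Factorial_Ring.prime p"
    and odd_p: "odd p"
    and t_pos: "t > 0"
    and s_pos: "s > 0"
    and p_ndvd_s: "\<not> p dvd s"
    and fin: "finite (carrier F)"
    and card_F: "card (carrier F) = (p ^ t) ^ s"
begin

abbreviation "r \<equiv> p ^ t"
abbreviation "q \<equiv> r ^ s"
abbreviation "Kr \<equiv> subfield_r F r"
abbreviation "Tr \<equiv> trace_qr F r s"
abbreviation "eta \<equiv> quad_char_r F r"
abbreviation "Fstar \<equiv> carrier F - {\<zero>}"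

lemma p_ge_3: "p \<ge> 3"
  using prime_ge_2_nat[OF prime_p] odd_p by (cases "p = 2") auto

lemma r_ge_3: "r \<ge> 3"
  using p_ge_3 t_pos self_le_power[of p t] by linarith

lemma odd_r: "odd r" using odd_p by simp

lemma q_eq: "q = r * (q div r)"
  using s_pos by (simp add: dvd_power)

lemma r_le_q: "r \<le> q"
  using r_ge_3 s_pos by (intro self_le_power) auto

lemma pow_zero_imp:
  assumes "x \<in> carrier F" "x [^] (n::nat) = \<zero>"
  shows "x = \<zero>"
  using assms(2)
proof (induction n)
  case (Suc n)
  then show ?case using assms(1) integral[of "x [^] n" x] by auto
qed simp

text \<open>The order of F is a power of p, so that multiple of 1 vanishes. It equals a power of
  \<open>[p] \<cdot> \<one>\<close>, and a field has no nonzero nilpotent elements.\<close>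

lemma char_p: "[p] \<cdot> \<one> = \<zero>"
proof -
  have *: "[(p ^ n)] \<cdot> \<one> = ([p] \<cdot> \<one>) [^] n" for n :: nat
  proof (induction n)
    case (Suc n)
    have "[(p ^ Suc n)] \<cdot> \<one> = [p] \<cdot> ([(p ^ n)] \<cdot> \<one>)"
      by (simp add: add.nat_pow_pow mult.commute)
    also have "\<dots> = ([(p ^ n)] \<cdot> \<one>) \<otimes> ([p] \<cdot> \<one>)"
      using add_pow_rdistr[of "[(p ^ n)] \<cdot> \<one>" \<one> p] by simp
    finally show ?case using Suc by simp
  qed simp
  have "[(p ^ (t * s))] \<cdot> \<one> = \<zero>"
    using add.pow_order_eq_1[of \<one>] card_F by (simp add: order_def power_mult)
  then show ?thesis using * pow_zero_imp by (metis add.nat_pow_closed one_closed)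
qed

lemma add_pow_p_power:
  assumes "x \<in> carrier F" "y \<in> carrier F"
  shows "(x \<oplus> y) [^] (p ^ n) = x [^] (p ^ n) \<oplus> y [^] (p ^ n)"
proof (induction n)
  case 0
  then show ?case using assms by simp
next
  case (Suc n)
  have "(x \<oplus> y) [^] (p ^ Suc n) = ((x \<oplus> y) [^] (p ^ n)) [^] p"
    using assms by (simp add: nat_pow_pow mult.commute)
  also have "\<dots> = (x [^] (p ^ n) \<oplus> y [^] (p ^ n)) [^] p" using Suc by simp
  also have "\<dots> = (x [^] (p ^ n)) [^] p \<oplus> (y [^] (p ^ n)) [^] p"
    using assms by (intro frobenius_add prime_p char_p) auto
  finally show ?case using assms by (simp add: nat_pow_pow mult.commute)
qed

lemma add_pow_r_power:
  assumes "x \<in> carrier F" "y \<in> carrier F"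
  shows "(x \<oplus> y) [^] (r ^ n) = x [^] (r ^ n) \<oplus> y [^] (r ^ n)"
  using add_pow_p_power[OF assms, of "t * n"] by (simp add: power_mult)

lemma Fstar_group: "group (Multiplicative_Group.mult_of F)" by (rule field_mult_group)

lemma order_mult: "order (Multiplicative_Group.mult_of F) = q - 1"
  using order_mult_of[OF fin] card_F by (simp add: order_def)

lemma pow_q: "x [^] q = x" if x: "x \<in> carrier F"
proof (cases "x = \<zero>")
  case True
  have "q > 0" using p_ge_3 by simp
  then show ?thesis using True by (simp add: nat_pow_zero)
next
  case False
  then have "x [^] (q - 1) = \<one>"
    using group.pow_order_eq_1[OF Fstar_group, of x] x order_mult by (simp add: Multiplicative_Group.nat_pow_mult_of)
  moreover have "x [^] q = x [^] (q - 1) \<otimes> x"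
  proof -
    have "q > 0" using p_ge_3 by simp
    then have "q = Suc (q - 1)" by simp
    then show ?thesis by (metis nat_pow_Suc)
  qed
  ultimately show ?thesis using x by simp
qed

text \<open>A generator is fixed once; the subfield, \<open>eta\<close> and the characters are all
  analysed through exponents of it.\<close>

definition gen where "gen = (SOME a. a \<in> Fstar \<and> Fstar = {a [^] i | i::nat. i \<in> UNIV})"

lemma gen_in: "gen \<in> Fstar" and gen_gen: "Fstar = {gen [^] i | i::nat. i \<in> UNIV}"
proof -
  have "\<exists>a. a \<in> Fstar \<and> Fstar = {a [^] i | i::nat. i \<in> UNIV}"
    using finite_field_mult_group_has_gen[OF fin] by (auto simp: Multiplicative_Group.nat_pow_mult_of)
  from someI_ex[OF this] show "gen \<in> Fstar" "Fstar = {gen [^] i | i::nat. i \<in> UNIV}"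
    unfolding gen_def by blast+
qed

lemma ord_gen: "group.ord (Multiplicative_Group.mult_of F) gen = q - 1"
proof -
  interpret G: group "Multiplicative_Group.mult_of F" by (rule Fstar_group)
  have fm: "finite (carrier (Multiplicative_Group.mult_of F))" using fin by simp
  have "G.ord gen = card (generate (Multiplicative_Group.mult_of F) {gen})"
    using gen_in by (intro G.generate_pow_card) auto
  also have "generate (Multiplicative_Group.mult_of F) {gen} = carrier (Multiplicative_Group.mult_of F)"
    using G.generate_pow_on_finite_carrier[OF fm, of gen] gen_in gen_gen
    by (simp add: Multiplicative_Group.nat_pow_mult_of)
  finally show ?thesis using order_mult by (simp add: order_def)
qed

lemma gen_pow_eq_one_iff: "gen [^] (n::nat) = \<one> \<longleftrightarrow> (q - 1) dvd n"
  using group.pow_eq_id[OF Fstar_group, of gen n] gen_in ord_gen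
  by (simp add: Multiplicative_Group.nat_pow_mult_of)

subsection \<open>The subfield of order r and its quadratic character\<close>

lemma gen_carrier [simp]: "gen \<in> carrier F" and gen_nonzero [simp]: "gen \<noteq> \<zero>"
  using gen_in by auto

lemma Kr_carrier: "y \<in> Kr \<Longrightarrow> y \<in> carrier F"
  and Kr_pow: "y \<in> Kr \<Longrightarrow> y [^] r = y"
  by (auto simp: subfield_r_def)

lemma finite_Kr [simp]: "finite Kr"
  using fin by (simp add: subfield_r_def)

lemma Kr_zero: "\<zero> \<in> Kr"
proof -
  have "r \<noteq> 0" using r_ge_3 by linarith
  then show ?thesis by (simp add: subfield_r_def nat_pow_zero)
qed

lemma Kr_one: "\<one> \<in> Kr"
  by (simp add: subfield_r_def)

lemma Kr_add:
  assumes "x \<in> Kr" "y \<in> Kr" shows "x \<oplus> y \<in> Kr"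
  using assms add_pow_r_power[of x y 1] by (simp add: subfield_r_def)

lemma Kr_mult:
  assumes "x \<in> Kr" "y \<in> Kr" shows "x \<otimes> y \<in> Kr"
  using assms by (simp add: subfield_r_def nat_pow_distrib)

lemma Kr_minus:
  assumes "x \<in> Kr" shows "\<ominus> x \<in> Kr"
proof -
  have x: "x \<in> carrier F" "x [^] r = x" using assms by (auto simp: subfield_r_def)
  have "(\<ominus> x) [^] r \<oplus> x [^] r = \<zero> [^] r"
    using add_pow_r_power[of "\<ominus> x" x 1] x by (simp add: l_neg)
  then have "(\<ominus> x) [^] r \<oplus> x = \<zero>"
    using x Kr_pow[OF Kr_zero] by simp
  then have "(\<ominus> x) [^] r = \<ominus> x"
    using x sum_zero_eq_neg[of "(\<ominus> x) [^] r" x] by simp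
  then show ?thesis using x by (simp add: subfield_r_def)
qed

lemma Fstar_inv: "x \<in> Fstar \<Longrightarrow> inv x \<in> Fstar"
  and Fstar_r_inv: "x \<in> Fstar \<Longrightarrow> x \<otimes> inv x = \<one>"
  and Fstar_l_inv: "x \<in> Fstar \<Longrightarrow> inv x \<otimes> x = \<one>"
  and Fstar_mult: "x \<in> Fstar \<Longrightarrow> y \<in> Fstar \<Longrightarrow> x \<otimes> y \<in> Fstar"
  using field_Units Units_inv_Units by (auto simp: integral_iff)

lemma Kr_inv:
  assumes "x \<in> Kr - {\<zero>}" shows "inv x \<in> Kr - {\<zero>}"
proof -
  have x: "x \<in> Fstar" "x [^] r = x" using assms by (auto simp: subfield_r_def)
  note i = Fstar_inv[OF x(1)]
  have "x [^] r \<otimes> (inv x) [^] r = \<one> [^] r"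
    using x i Fstar_r_inv[OF x(1)] by (subst nat_pow_distrib[symmetric]) auto
  then have "x \<otimes> (inv x) [^] r = \<one>" using x by simp
  then have "inv x = (inv x) [^] r" using x i by (intro comm_inv_char) auto
  then show ?thesis using i by (auto simp: subfield_r_def)
qed

lemma gen_pow_nonzero: "gen [^] (i::nat) \<noteq> \<zero>"
  using pow_zero_imp[of gen i] by auto

lemma r_minus_1_dvd: "(r - 1) dvd (q - 1)"
proof -
  have "(r - 1) dvd (r ^ n - 1)" for n
  proof (induction n)
    case (Suc n)
    have "r ^ n > 0" using r_ge_3 by (simp add: prime_gt_0_nat prime_p)
    then have "r ^ Suc n - 1 = r * (r ^ n - 1) + (r - 1)"
      using r_ge_3 by (simp add: algebra_simps)
    then show ?case using Suc by simp
  qed simp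
  then show ?thesis .
qed

text \<open>Since \<open>gen\<close> has order q - 1, this exponent makes the order of
  \<open>hgen\<close> exactly r - 1, so that it generates the nonzero elements of the
  subfield.\<close>

definition "hgen = gen [^] ((q - 1) div (r - 1))"

lemma hgen_pow_eq_one_iff: "hgen [^] (n::nat) = \<one> \<longleftrightarrow> (r - 1) dvd n"
proof -
  obtain m where m: "q - 1 = (r - 1) * m" using r_minus_1_dvd by blast
  have r0: "r - 1 > 0" using r_ge_3 by linarith
  have "q - 1 > 0" using r_ge_3 r_le_q by linarith
  then have m0: "m > 0" using m by (cases m) auto
  have "hgen [^] n = gen [^] (m * n)"
    using r0 unfolding hgen_def m by (simp add: nat_pow_pow)
  then show ?thesis using gen_pow_eq_one_iff[of "m * n"] m m0 by (simp add: mult.commute)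
qed

lemma hgen_carrier [simp]: "hgen \<in> carrier F" and hgen_nonzero [simp]: "hgen \<noteq> \<zero>"
  using gen_pow_nonzero by (simp_all add: hgen_def)

lemma hgen_pow_nonzero: "hgen [^] (i::nat) \<noteq> \<zero>"
  using pow_zero_imp[of hgen i] by auto

lemma pow_eq_imp_diff_one:
  assumes "a \<in> Fstar" "i \<le> j" "a [^] i = a [^] (j::nat)"
  shows "a [^] (j - i) = \<one>"
proof -
  have nz: "a [^] i \<noteq> \<zero>" using pow_zero_imp[of a i] assms by auto
  have "a [^] i \<otimes> a [^] (j - i) = a [^] i \<otimes> \<one>"
    using assms nat_pow_mult[of a i "j - i"] by simp
  then show ?thesis using nz assms m_lcancel[of "a [^] i" "a [^] (j - i)" \<one>] by simp
qed

lemma hgen_in_Kr: "hgen [^] (i::nat) \<in> Kr"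
proof -
  have "hgen [^] r = hgen"
  proof -
    have "r = Suc (r - 1)" using r_ge_3 by linarith
    moreover have "hgen [^] (r - 1) = \<one>" using hgen_pow_eq_one_iff by simp
    ultimately show ?thesis by (metis hgen_carrier l_one nat_pow_Suc)
  qed
  then have "(hgen [^] i) [^] r = hgen [^] i"
    by (simp add: nat_pow_pow mult.commute[of i]) (simp flip: nat_pow_pow)
  then show ?thesis by (simp add: subfield_r_def)
qed

text \<open>For y = gen^i the equation y^(r-1) = 1 means that q - 1 divides i (r - 1), so i is a
  multiple of (q - 1)/(r - 1).\<close>

lemma Kr_gen: "y \<in> Kr - {\<zero>} \<Longrightarrow> \<exists>i::nat. y = hgen [^] i"
proof -
  assume y: "y \<in> Kr - {\<zero>}"
  then have "y \<in> Fstar" by (auto simp: subfield_r_def)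
  then obtain i :: nat where i: "y = gen [^] i" using gen_gen by blast
  have r0: "r - 1 > 0" "1 \<le> r" using r_ge_3 by linarith+
  obtain m where m: "q - 1 = (r - 1) * m" using r_minus_1_dvd by blast
  have "y [^] (1::nat) = y [^] r" using y by (auto simp: subfield_r_def nat_pow_eone)
  then have "y [^] (r - 1) = \<one>"
    using pow_eq_imp_diff_one[OF \<open>y \<in> Fstar\<close> r0(2)] by blast
  then have "gen [^] (i * (r - 1)) = \<one>" using i by (simp add: nat_pow_pow)
  then have "(r - 1) * m dvd (r - 1) * i" using gen_pow_eq_one_iff m by (simp add: mult.commute)
  then have "m dvd i" using r0 by simp
  then obtain k where "i = m * k" by blast
  then have "y = hgen [^] k" using i r0 unfolding hgen_def m by (simp add: nat_pow_pow)
  then show ?thesis by blast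
qed

text \<open>Exponents of \<open>hgen\<close> matter only modulo r - 1. The bijection yields the
  order of the subfield and turns the sum of \<open>eta\<close> into an alternating sum over
  exponents.\<close>

lemma bij_hgen: "bij_betw (\<lambda>i. hgen [^] i) {..<r - 1} (Kr - {\<zero>})"
proof -
  have r0: "r - 1 > 0" using r_ge_3 by linarith
  have 1: "i = j" if "i \<le> j" "j < r - 1" "hgen [^] i = hgen [^] j" for i j :: nat
  proof -
    have "(r - 1) dvd (j - i)"
      using pow_eq_imp_diff_one[of hgen i j] that hgen_pow_eq_one_iff by simp
    then show ?thesis using that by (auto dest: dvd_imp_le)
  qed
  have inj: "inj_on (\<lambda>i::nat. hgen [^] i) {..<r - 1}"
  proof (rule inj_onI)
    fix i j :: nat assume "i \<in> {..<r - 1}" "j \<in> {..<r - 1}" "hgen [^] i = hgen [^] j"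
    then show "i = j" using 1[of i j] 1[of j i] by (cases "i \<le> j") auto
  qed
  have surj: "y \<in> (\<lambda>i::nat. hgen [^] i) ` {..<r - 1}" if y: "y \<in> Kr - {\<zero>}" for y
  proof -
    obtain i :: nat where i: "y = hgen [^] i" using Kr_gen[OF y] by blast
    have "hgen [^] i = hgen [^] ((r - 1) * (i div (r - 1)) + i mod (r - 1))"
      by simp
    also have "\<dots> = hgen [^] ((r - 1) * (i div (r - 1))) \<otimes> hgen [^] (i mod (r - 1))"
      by (simp only: nat_pow_mult hgen_carrier)
    also have "hgen [^] ((r - 1) * (i div (r - 1))) = \<one>"
      using hgen_pow_eq_one_iff[of "(r - 1) * (i div (r - 1))"] by (meson dvd_triv_left)
    finally have "y = hgen [^] (i mod (r - 1))" using i by simp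
    then show ?thesis using r0 by (intro image_eqI) auto
  qed
  show ?thesis unfolding bij_betw_def
    using inj surj hgen_in_Kr hgen_pow_nonzero by auto
qed

lemma card_Kr: "card Kr = r"
proof -
  have "card (Kr - {\<zero>}) = r - 1"
    using bij_betw_same_card[OF bij_hgen] by simp
  moreover have "card Kr > 0" using Kr_zero by (auto simp: card_gt_0_iff)
  ultimately show ?thesis using Kr_zero r_ge_3 by (simp add: card_Diff_singleton)
qed

lemma eta_zero [simp]: "eta \<zero> = 0" by (simp add: quad_char_r_def)

text \<open>Because r is odd, r - 1 is even and the parity of an exponent is well defined; the
  squares are the even powers. Multiplicativity and the vanishing sum of \<open>eta\<close> follow
  from this explicit form.\<close>

lemma eta_hgen: "eta (hgen [^] (i::nat)) = (-1) ^ i"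
proof -
  have "(\<exists>z\<in>Kr. z \<otimes> z = hgen [^] i) \<longleftrightarrow> even i"
  proof
    assume "\<exists>z\<in>Kr. z \<otimes> z = hgen [^] i"
    then obtain z where z: "z \<in> Kr" "z \<otimes> z = hgen [^] i" by blast
    have zc: "z \<in> carrier F" using z Kr_carrier by blast
    have "z \<noteq> \<zero>" using z hgen_pow_nonzero[of i] by auto
    then obtain j :: nat where j: "z = hgen [^] j" using Kr_gen z by blast
    have e: "hgen [^] (j + j) = hgen [^] i" using z j by (simp add: nat_pow_mult)
    have ev: "even (r - 1)" using odd_r by simp
    show "even i"
    proof (cases "j + j \<le> i")
      case True
      then have "(r - 1) dvd (i - (j + j))"
        using pow_eq_imp_diff_one[of hgen "j + j" i] e hgen_pow_eq_one_iff by simp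
      then have "even (i - (j + j))" using ev dvd_trans by blast
      then show ?thesis using True by (simp add: even_diff_nat)
    next
      case False
      then have "(r - 1) dvd ((j + j) - i)"
        using pow_eq_imp_diff_one[of hgen i "j + j"] e hgen_pow_eq_one_iff by simp
      then have "even ((j + j) - i)" using ev dvd_trans by blast
      then show ?thesis using False by (simp add: even_diff_nat)
    qed
  next
    assume "even i"
    then obtain k where "i = k + k" by (metis evenE mult_2)
    then show "\<exists>z\<in>Kr. z \<otimes> z = hgen [^] i"
      using hgen_in_Kr[of k] nat_pow_mult[of hgen k k] by auto
  qed
  then show ?thesis using hgen_pow_nonzero by (auto simp: quad_char_r_def)
qed

lemma eta_mult:
  assumes "x \<in> Kr" "y \<in> Kr"
  shows "eta (x \<otimes> y) = eta x * eta y"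
proof (cases "x = \<zero> \<or> y = \<zero>")
  case True
  then show ?thesis using assms Kr_carrier by auto
next
  case False
  then obtain i j :: nat where "x = hgen [^] i" "y = hgen [^] j"
    using assms Kr_gen by (meson DiffI singletonD)
  then show ?thesis by (simp add: nat_pow_mult eta_hgen power_add)
qed

lemma eta_values:
  assumes "x \<in> Kr" "x \<noteq> \<zero>" shows "eta x = 1 \<or> eta x = -1"
  by (simp add: quad_char_r_def assms)

lemma eta_square:
  assumes "x \<in> Kr" "x \<noteq> \<zero>" shows "eta x * eta x = 1"
  using eta_values[OF assms] by auto

lemma eta_one [simp]: "eta \<one> = 1" using eta_hgen[of 0] by simp

lemma eta_sum: "(\<Sum>y\<in>Kr. eta y) = 0"
proof -
  have "(\<Sum>y\<in>Kr. eta y) = (\<Sum>y\<in>Kr - {\<zero>}. eta y)"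
    using Kr_zero by (simp add: sum.remove[of Kr \<zero>])
  also have "\<dots> = (\<Sum>i<r - 1. (-1) ^ i)"
    using sum.reindex_bij_betw[OF bij_hgen, of eta] by (simp add: eta_hgen)
  also have "\<dots> = 0"
  proof -
    have "(\<Sum>i<2 * n. (-1::real) ^ i) = 0" for n :: nat
      by (induction n) auto
    moreover have "even (r - 1)" using odd_r by simp
    ultimately show ?thesis by (metis evenE)
  qed
  finally show ?thesis .
qed

text \<open>Translating by b leaves the sum of eta(d + e) eta(d) with e = a - b. This
  near-orthogonality of translates lets the second moment of \<open>twisted_sum\<close> be computed
  from that of \<open>fiber_sum\<close>.\<close>

lemma eta_correlation:
  assumes a: "a \<in> Kr" and b: "b \<in> Kr"
  shows "(\<Sum>c\<in>Kr. eta (a \<oplus> c) * eta (b \<oplus> c)) = (if a = b then real r - 1 else - 1)"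
proof -
  note car = Kr_carrier
  define A where "A d = eta (d \<oplus> (a \<ominus> b)) * eta d" for d
  have ab: "a \<ominus> b \<in> Kr" using Kr_add[OF a Kr_minus[OF b]] by (simp add: minus_eq)
  note [simp] = car[OF a] car[OF b] car[OF ab]
  have bij: "bij_betw (\<lambda>c. b \<oplus> c) Kr Kr"
  proof (rule bij_betwI[where g = "\<lambda>c. \<ominus> b \<oplus> c"])
    show "(\<oplus>) b \<in> Kr \<rightarrow> Kr" "(\<oplus>) (\<ominus> b) \<in> Kr \<rightarrow> Kr"
      using b Kr_add Kr_minus by auto
  qed (use car in \<open>auto simp: r_neg1 r_neg2\<close>)
  have shift: "b \<oplus> c \<oplus> (a \<ominus> b) = a \<oplus> c" if "c \<in> Kr" for c
    using car[OF that] car[OF a] car[OF b] by algebra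
  have "(\<Sum>c\<in>Kr. eta (a \<oplus> c) * eta (b \<oplus> c)) = (\<Sum>c\<in>Kr. A (b \<oplus> c))"
    by (intro sum.cong) (auto simp: A_def shift)
  also have "\<dots> = (\<Sum>d\<in>Kr. A d)" by (rule sum.reindex_bij_betw[OF bij])
  also have "\<dots> = (\<Sum>d\<in>Kr - {\<zero>}. A d)"
    using Kr_zero by (simp add: sum.remove[of Kr \<zero>] A_def)
  finally have red: "(\<Sum>c\<in>Kr. eta (a \<oplus> c) * eta (b \<oplus> c)) = (\<Sum>d\<in>Kr - {\<zero>}. A d)" .
  show ?thesis
  proof (cases "a = b")
    case True
    have "A d = 1" if "d \<in> Kr - {\<zero>}" for d
      using that True car[of d] eta_square[of d] r_neg[of b] by (simp add: A_def minus_eq)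
    then have "(\<Sum>d\<in>Kr - {\<zero>}. A d) = real (card (Kr - {\<zero>}))" by simp
    also have "card (Kr - {\<zero>}) = r - 1" using card_Kr Kr_zero by (simp add: card_Diff_singleton)
    finally show ?thesis using red True r_ge_3 by simp
  next
    case False
    define e where "e = a \<ominus> b"
    have e: "e \<in> Kr - {\<zero>}" using ab False by (simp add: e_def)
    have A_eq: "A d = eta (\<one> \<oplus> e \<otimes> inv d)" if d: "d \<in> Kr - {\<zero>}" for d
    proof -
      have dF: "d \<in> Fstar" "e \<in> carrier F" using d e car by auto
      have k: "\<one> \<oplus> e \<otimes> inv d \<in> Kr"
        using Kr_inv[OF d] e by (intro Kr_add Kr_mult Kr_one) auto
      have "d \<oplus> e = (\<one> \<oplus> e \<otimes> inv d) \<otimes> d"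
        using dF Fstar_inv[OF dF(1)] Fstar_l_inv[OF dF(1)]
        by (simp add: l_distr m_assoc)
      then have "A d = eta (\<one> \<oplus> e \<otimes> inv d) * (eta d * eta d)"
        using eta_mult[OF k] d by (simp add: A_def e_def)
      then show ?thesis using eta_square[of d] d by simp
    qed
    \<comment> \<open>\<open>A d = eta (1 + e / d)\<close>, and \<open>1 + e / d\<close> runs through everything except 1.\<close>
    have inv_bij: "bij_betw (\<lambda>d. e \<otimes> inv d) (Kr - {\<zero>}) (Kr - {\<zero>})"
    \<comment> \<open>The map d -> e/d is an involution and hence its own inverse; each of the two
      facts below therefore serves two of the four goals.\<close>
    proof (rule bij_betw_byWitness[where f' = "\<lambda>d. e \<otimes> inv d"])
      have *: "e \<otimes> inv d \<in> Kr - {\<zero>}" if "d \<in> Kr - {\<zero>}" for d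
        using Kr_inv[OF that] e Kr_mult car by (auto simp: integral_iff)
      have **: "e \<otimes> inv (e \<otimes> inv d) = d" if "d \<in> Kr - {\<zero>}" for d
      proof -
        have f: "d \<in> Fstar" "e \<in> Fstar" "e \<otimes> inv d \<in> Fstar"
          using that e car *[OF that] by auto
        note i = Fstar_inv[OF f(1)] Fstar_inv[OF f(2)]
        have "e \<otimes> inv d \<otimes> (d \<otimes> inv e) = e \<otimes> (inv d \<otimes> d) \<otimes> inv e"
          using f i by (simp add: m_ac)
        also have "\<dots> = \<one>" using f i Fstar_l_inv Fstar_r_inv by simp
        finally have "inv (e \<otimes> inv d) = d \<otimes> inv e"
          using f i by (intro comm_inv_char) auto
        then have "e \<otimes> inv (e \<otimes> inv d) = d \<otimes> (e \<otimes> inv e)"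
          using f(1,2) i m_lcomm[of e d "inv e"] by simp
        then show ?thesis using f(1) Fstar_r_inv[OF f(2)] by simp
      qed
      show inverse: "\<forall>a\<in>Kr - {\<zero>}. e \<otimes> inv (e \<otimes> inv a) = a" using ** by blast
      show "\<forall>a\<in>Kr - {\<zero>}. e \<otimes> inv (e \<otimes> inv a) = a" by (rule inverse)
      show sub: "(\<lambda>d. e \<otimes> inv d) ` (Kr - {\<zero>}) \<subseteq> Kr - {\<zero>}" using * by (intro image_subsetI)
      show "(\<lambda>d. e \<otimes> inv d) ` (Kr - {\<zero>}) \<subseteq> Kr - {\<zero>}" by (rule sub)
    qed
    have one_bij: "bij_betw (\<lambda>c. \<one> \<oplus> c) Kr Kr"
    proof (rule bij_betwI[where g = "\<lambda>c. \<ominus> \<one> \<oplus> c"])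
      show "(\<oplus>) \<one> \<in> Kr \<rightarrow> Kr" "(\<oplus>) (\<ominus> \<one>) \<in> Kr \<rightarrow> Kr"
        using Kr_one Kr_add Kr_minus by auto
    qed (use car in \<open>auto simp: r_neg1 r_neg2\<close>)
    have "(\<Sum>d\<in>Kr - {\<zero>}. A d) = (\<Sum>d\<in>Kr - {\<zero>}. eta (\<one> \<oplus> e \<otimes> inv d))"
      using A_eq by (intro sum.cong) auto
    also have "\<dots> = (\<Sum>d\<in>Kr - {\<zero>}. eta (\<one> \<oplus> d))"
      by (rule sum.reindex_bij_betw[OF inv_bij])
    also have "\<dots> = (\<Sum>d\<in>Kr. eta (\<one> \<oplus> d)) - 1"
      using Kr_zero by (simp add: sum.remove[of Kr \<zero>])
    also have "(\<Sum>d\<in>Kr. eta (\<one> \<oplus> d)) = 0"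
      using sum.reindex_bij_betw[OF one_bij, of eta] eta_sum by simp
    finally show ?thesis using red False by simp
  qed
qed

subsection \<open>The trace\<close>

lemma trace_Suc:
  assumes "x \<in> carrier F"
  shows "trace_qr F r (Suc n) x = trace_qr F r n x \<oplus> x [^] (r ^ n)"
  using assms by (simp add: trace_qr_def lessThan_Suc a_comm)

lemma trace_0: "trace_qr F r 0 x = \<zero>"
  by (simp add: trace_qr_def)

lemma trace_carrier: "x \<in> carrier F \<Longrightarrow> trace_qr F r n x \<in> carrier F"
  by (auto simp: trace_qr_def)

lemma trace_add:
  assumes "x \<in> carrier F" "y \<in> carrier F"
  shows "trace_qr F r n (x \<oplus> y) = trace_qr F r n x \<oplus> trace_qr F r n y"
proof (induction n)
  case (Suc n)
  then show ?case
    using assms by (simp add: trace_Suc trace_carrier add_pow_r_power a_ac)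
qed (simp add: trace_0)

lemma Kr_pow_power: "c \<in> Kr \<Longrightarrow> c [^] (r ^ n) = c"
proof (induction n)
  case (Suc n)
  then show ?case
    using Kr_carrier[OF Suc.prems] Kr_pow[OF Suc.prems] by (simp flip: nat_pow_pow)
qed (simp add: Kr_carrier)

lemma trace_scale:
  assumes "c \<in> Kr" "x \<in> carrier F"
  shows "trace_qr F r n (c \<otimes> x) = c \<otimes> trace_qr F r n x"
proof (induction n)
  case (Suc n)
  then show ?case
    using assms Kr_carrier[OF assms(1)]
    by (simp add: trace_Suc trace_carrier nat_pow_distrib Kr_pow_power r_distr)
qed (use assms Kr_carrier in \<open>simp add: trace_0\<close>)

text \<open>Raising to the power r shifts the summands of the trace by one. For a partial trace of
  length n only the end terms x and x^(r^n) differ, and at n = s they agree because x^q = x.\<close>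

lemma trace_in_Kr:
  assumes x: "x \<in> carrier F" shows "Tr x \<in> Kr"
proof -
  have *: "trace_qr F r n x [^] r \<oplus> x = trace_qr F r n x \<oplus> x [^] (r ^ n)" for n
  proof (induction n)
    case 0
    show ?case using x Kr_pow[OF Kr_zero] by (simp add: trace_0)
  next
    case (Suc n)
    let ?T = "trace_qr F r n x"
    have T: "?T \<in> carrier F" using x trace_carrier by blast
    have "trace_qr F r (Suc n) x [^] r \<oplus> x = ?T [^] r \<oplus> (x [^] (r ^ n)) [^] r \<oplus> x"
      using add_pow_r_power[of ?T "x [^] (r ^ n)" 1] x T by (simp add: trace_Suc)
    also have "\<dots> = (?T [^] r \<oplus> x) \<oplus> x [^] (r ^ Suc n)"
      using x T by (simp add: nat_pow_pow a_ac mult.commute)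
    finally show ?case using Suc x by (simp add: trace_Suc)
  qed
  have T: "Tr x \<in> carrier F" using x trace_carrier by blast
  have "Tr x [^] r \<oplus> x = Tr x \<oplus> x" using *[of s] pow_q[OF x] by simp
  then have "Tr x [^] r = Tr x" using T x by (simp add: add.right_cancel)
  then show ?thesis using T by (simp add: subfield_r_def)
qed

definition "tr_one = [s] \<cdot> \<one>"

lemma trace_one: "Tr \<one> = tr_one"
proof -
  have "trace_qr F r n \<one> = [n] \<cdot> \<one>" for n
    by (induction n) (auto simp: trace_0 trace_Suc)
  then show ?thesis by (simp add: tr_one_def)
qed

lemma tr_one_Kr: "tr_one \<in> Kr" using trace_in_Kr[of \<one>] trace_one by simp

text \<open>The additive order of 1 divides p; if \<open>tr_one\<close> were zero it would also
  divide s, which is coprime to p. This makes the trace surjective onto the subfield and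
  \<open>tr_one\<close> a legitimate scaling factor.\<close>

lemma tr_one_nonzero: "tr_one \<noteq> \<zero>"
proof
  assume "tr_one = \<zero>"
  then have "add.ord \<one> dvd s" using add.pow_eq_id[of \<one> s] by (simp add: tr_one_def)
  moreover have "add.ord \<one> dvd p" using add.pow_eq_id[of \<one> p] char_p by simp
  moreover have "coprime p s" using prime_p p_ndvd_s by (simp add: prime_imp_coprime)
  ultimately have "add.ord \<one> = 1" by (meson coprime_common_divisor_nat)
  then have "\<one> = \<zero>" using add.ord_eq_1[of \<one>] by simp
  then show False by simp
qed

text \<open>The subfield element y / \<open>tr_one\<close> has trace y by linearity, so every fibre
  is a translate of the kernel. The r fibres of equal size partition the q elements of F.\<close>

lemma trace_fiber:
  assumes y: "y \<in> Kr"
  shows "card {x \<in> carrier F. Tr x = y} = q div r"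
proof -
  let ?f = "\<lambda>y. {x \<in> carrier F. Tr x = y}"
  have eq: "card (?f y) = card (?f \<zero>)" if y: "y \<in> Kr" for y
  proof -
    define a where "a = y \<otimes> inv tr_one"
    have sg: "tr_one \<in> Fstar" using tr_one_Kr tr_one_nonzero Kr_carrier by auto
    have yi: "y \<in> carrier F" "inv tr_one \<in> carrier F" using y Kr_carrier Fstar_inv[OF sg] by auto
    have aK: "a \<in> Kr"
      using Kr_mult[OF y] Kr_inv[of tr_one] tr_one_Kr tr_one_nonzero by (simp add: a_def)
    note a = Kr_carrier[OF aK]
    have "Tr a = a \<otimes> tr_one" using trace_scale[OF aK, of \<one> s] a trace_one by simp
    also have "\<dots> = y" using yi sg Fstar_l_inv[OF sg] by (simp add: a_def m_assoc)
    finally have Ta: "Tr a = y" .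
    have "bij_betw (\<lambda>x. a \<oplus> x) (?f \<zero>) (?f y)"
    proof (rule bij_betwI[where g = "\<lambda>x. \<ominus> a \<oplus> x"])
      show "(\<oplus>) a \<in> ?f \<zero> \<rightarrow> ?f y" using a yi Ta by (auto simp: trace_add)
      have "y \<oplus> Tr (\<ominus> a) = \<zero>"
        using trace_add[of a "\<ominus> a" s] a Ta trace_scale[OF Kr_zero, of \<one> s] trace_carrier
        by (simp add: r_neg)
      then have "Tr (\<ominus> a) \<oplus> y = \<zero>" using a yi trace_carrier by (simp add: a_comm)
      then show "(\<oplus>) (\<ominus> a) \<in> ?f y \<rightarrow> ?f \<zero>"
        using a by (auto simp: trace_add)
    qed (use a in \<open>auto simp: r_neg1 r_neg2\<close>)
    then show ?thesis by (simp add: bij_betw_same_card)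
  qed
  have "q = card (\<Union>y\<in>Kr. ?f y)"
  proof -
    have "(\<Union>y\<in>Kr. ?f y) = carrier F" using trace_in_Kr by auto
    then show ?thesis using card_F by simp
  qed
  also have "\<dots> = (\<Sum>y\<in>Kr. card (?f y))"
    using fin by (intro card_UN_disjoint) auto
  also have "\<dots> = r * card (?f \<zero>)" using eq card_Kr by simp
  finally have "q = r * card (?f \<zero>)" .
  then have "q div r = card (?f \<zero>)" using p_ge_3 by (metis nonzero_mult_div_cancel_left not_numeral_le_zero r_ge_3)
  then show ?thesis using eq[OF y] by simp
qed

subsection \<open>Character sums along the fibres of the trace\<close>

lemma finite_Fstar [simp]: "finite Fstar" using fin by simp

lemma card_Fstar: "card Fstar = q - 1"
  using card_F by (simp add: card_Diff_singleton)

lemma Kr_Fstar: "c \<in> Kr - {\<zero>} \<Longrightarrow> c \<in> Fstar"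
  using Kr_carrier by auto

lemma bij_mult:
  assumes "a \<in> Fstar"
  shows "bij_betw (\<lambda>x. a \<otimes> x) Fstar Fstar"
proof (rule bij_betw_byWitness[where f' = "\<lambda>x. inv a \<otimes> x"])
  note i = Fstar_inv[OF assms]
  show "\<forall>x\<in>Fstar. inv a \<otimes> (a \<otimes> x) = x"
    using i assms Fstar_l_inv[OF assms] by (auto simp flip: m_assoc)
  show "\<forall>x\<in>Fstar. a \<otimes> (inv a \<otimes> x) = x"
    using i assms Fstar_r_inv[OF assms] by (auto simp flip: m_assoc)
qed (use assms Fstar_inv[OF assms] in \<open>auto simp: integral_iff\<close>)

text \<open>With x = q these bring the two second moments to the product of r - 1 and a bound, as
  \<open>scale_bound\<close> requires.\<close>

lemma real_r_identity:
  "real r * (x - x / real r) = x * (real r - 1)"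
  "x - x / real r = (real r - 1) * (x / real r)"
proof -
  have *: "a * (x - x / a) = x * (a - 1) \<and> x - x / a = (a - 1) * (x / a)" if "a > 0" for a :: real
    using that by (simp add: field_simps)
  have "real r > 0" using r_ge_3 by linarith
  from *[OF this] show "real r * (x - x / real r) = x * (real r - 1)"
    "x - x / real r = (real r - 1) * (x / real r)" by blast+
qed

section \<open>Multiplicative characters: elementary properties and orthogonality\<close>

lemma char_mult:
  assumes "\<xi> \<in> mult_chars F" "x \<in> Fstar" "y \<in> Fstar"
  shows "\<xi> (x \<otimes> y) = \<xi> x * \<xi> y"
  using assms by (auto simp: mult_chars_def)

lemma char_nonzero:
  assumes "\<xi> \<in> mult_chars F" "x \<in> Fstar"
  shows "\<xi> x \<noteq> 0"
  using assms by (auto simp: mult_chars_def)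

lemma char_outside:
  assumes "\<xi> \<in> mult_chars F" "x \<notin> Fstar"
  shows "\<xi> x = 0"
  using assms by (auto simp: mult_chars_def)

lemma char_one:
  assumes "\<xi> \<in> mult_chars F" shows "\<xi> \<one> = 1"
  using char_mult[OF assms, of \<one> \<one>] char_nonzero[OF assms, of \<one>] by simp

lemma char_pow:
  assumes "\<xi> \<in> mult_chars F" "x \<in> Fstar"
  shows "\<xi> (x [^] (n::nat)) = \<xi> x ^ n"
proof (induction n)
  case (Suc n)
  have "x [^] n \<in> Fstar" using assms pow_zero_imp[of x n] by auto
  then show ?case using Suc char_mult[OF assms(1)] assms by simp
qed (simp add: char_one[OF assms(1)])

lemma Fstar_pow_order: "x \<in> Fstar \<Longrightarrow> x [^] (q - 1) = \<one>"
  using group.pow_order_eq_1[OF Fstar_group, of x] order_mult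
  by (simp add: Multiplicative_Group.nat_pow_mult_of)

lemma q_gt_2: "q > 2" using r_ge_3 r_le_q by linarith

lemma char_norm:
  assumes "\<xi> \<in> mult_chars F" "x \<in> Fstar"
  shows "cmod (\<xi> x) = 1"
proof -
  have "\<xi> x ^ (q - 1) = 1"
    using char_pow[OF assms, of "q - 1"] Fstar_pow_order[OF assms(2)] char_one[OF assms(1)] by simp
  then have "cmod (\<xi> x) ^ (q - 1) = 1" by (metis norm_one norm_power)
  then show ?thesis using q_gt_2 power_eq_imp_eq_base[of "cmod (\<xi> x)" "q - 1" 1] by simp
qed

lemma char_cnj:
  assumes "\<xi> \<in> mult_chars F" "x \<in> Fstar"
  shows "\<xi> x * cnj (\<xi> x) = 1"
  using char_norm[OF assms] by (simp add: complex_norm_square[symmetric])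

text \<open>The value 0 off F^* follows the convention of \<open>mult_chars\<close>, so that
  equality of characters is equality of functions.\<close>

definition "triv_char x = (if x \<in> Fstar then 1 else 0 :: complex)"

lemma triv_char_mem: "triv_char \<in> mult_chars F"
  unfolding mult_chars_def using Fstar_mult by (auto simp: triv_char_def)

lemma char_prod_cnj:
  assumes "\<phi> \<in> mult_chars F" "\<psi> \<in> mult_chars F"
  shows "(\<lambda>x. \<phi> x * cnj (\<psi> x)) \<in> mult_chars F"
  using assms unfolding mult_chars_def by auto

text \<open>Multiplication by an a whose character value is not 1 permutes F^*, yet multiplies the
  sum by that value.\<close>

lemma char_sum_zero:
  assumes chi: "\<xi> \<in> mult_chars F" "\<xi> \<noteq> triv_char"
  shows "(\<Sum>x\<in>Fstar. \<xi> x) = 0"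
proof -
  obtain a where a: "\<xi> a \<noteq> triv_char a" using chi(2) by blast
  then have aF: "a \<in> Fstar" using char_outside[OF chi(1), of a] unfolding triv_char_def by metis
  then have "\<xi> a \<noteq> 1" using a by (simp add: triv_char_def)
  have "(\<Sum>x\<in>Fstar. \<xi> x) = (\<Sum>x\<in>Fstar. \<xi> (a \<otimes> x))"
    by (rule sum.reindex_bij_betw[OF bij_mult[OF aF], symmetric])
  also have "\<dots> = \<xi> a * (\<Sum>x\<in>Fstar. \<xi> x)"
    using char_mult[OF chi(1) aF] by (simp add: sum_distrib_left)
  finally show ?thesis using \<open>\<xi> a \<noteq> 1\<close> by simp
qed

text \<open>For u other than 1 the condition reads Tr((u - 1) x) = 0, and multiplication by u - 1
  carries the solutions to the kernel of the trace without 0. The right-hand side isolates a part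
  constant in u, which a nontrivial character later sums to zero.\<close>

lemma card_trace_fixed:
  assumes u: "u \<in> Fstar"
  shows "real (card {x \<in> Fstar. Tr (u \<otimes> x) = Tr x})
    = (real q / real r - 1) + of_bool (u = \<one>) * (real q - real q / real r)"
proof (cases "u = \<one>")
  case True
  then have "{x \<in> Fstar. Tr (u \<otimes> x) = Tr x} = Fstar" by auto
  then have "real (card {x \<in> Fstar. Tr (u \<otimes> x) = Tr x}) = real (q - 1)"
    using card_Fstar by simp
  then show ?thesis using True q_gt_2 by simp
next
  case False
  define v where "v = u \<ominus> \<one>"
  have v: "v \<in> Fstar" using u False by (auto simp: v_def)
  have iff: "Tr (u \<otimes> x) = Tr x \<longleftrightarrow> Tr (v \<otimes> x) = \<zero>" if "x \<in> Fstar" for x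
  proof -
    have "u \<otimes> x = v \<otimes> x \<oplus> x"
      using u that unfolding v_def by (simp add: minus_eq l_distr a_assoc l_neg l_minus)
    then have "Tr (u \<otimes> x) = Tr (v \<otimes> x) \<oplus> Tr x"
      using v that by (simp add: trace_add)
    then show ?thesis
      using v that trace_carrier by simp
  qed
  have "bij_betw (\<lambda>x. v \<otimes> x) {x \<in> Fstar. Tr (v \<otimes> x) = \<zero>} {z \<in> Fstar. Tr z = \<zero>}"
    by (rule bij_betw_Collect[OF bij_mult[OF v]]) simp
  then have "card {x \<in> Fstar. Tr (v \<otimes> x) = \<zero>} = card {z \<in> Fstar. Tr z = \<zero>}"
    by (rule bij_betw_same_card)
  also have "{z \<in> Fstar. Tr z = \<zero>} = {z \<in> carrier F. Tr z = \<zero>} - {\<zero>}" by auto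
  also have "card \<dots> = q div r - 1"
    using trace_fiber[OF Kr_zero] trace_scale[OF Kr_zero, of \<one> s] trace_carrier
    by (subst card_Diff_singleton) auto
  finally have "card {x \<in> Fstar. Tr (u \<otimes> x) = Tr x} = q div r - 1"
    using iff by (simp cong: conj_cong)
  moreover have "real (q div r) = real q / real r"
    using q_eq by (metis dvd_triv_left real_of_nat_div)
  moreover have "q div r \<ge> 1" using r_le_q r_ge_3 q_eq by (metis One_nat_def Suc_leI gr0I le_zero_eq mult_0_right not_numeral_le_zero)
  ultimately show ?thesis using False by simp
qed

text \<open>The sums below have constant modulus off zero, so a second moment bounds each of them
  and no Gauss or Jacobi sum has to be evaluated.\<close>
lemma scale_bound:
  fixes f :: "'a \<Rightarrow> complex"
  assumes f: "\<And>c. c \<in> Kr - {\<zero>} \<Longrightarrow> cmod (f c) = cmod (f \<one>)"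
    and total: "(\<Sum>c\<in>Kr. (cmod (f c))\<^sup>2) = (real r - 1) * B"
    and c: "c \<in> Kr - {\<zero>}"
  shows "cmod (f c) \<le> sqrt B"
proof -
  have "(real r - 1) * (cmod (f c))\<^sup>2 = (\<Sum>d\<in>Kr - {\<zero>}. (cmod (f d))\<^sup>2)"
  proof -
    have "(\<Sum>d\<in>Kr - {\<zero>}. (cmod (f d))\<^sup>2) = (\<Sum>d\<in>Kr - {\<zero>}. (cmod (f c))\<^sup>2)"
      using f c by (intro sum.cong) auto
    also have "\<dots> = real (card (Kr - {\<zero>})) * (cmod (f c))\<^sup>2" by simp
    also have "card (Kr - {\<zero>}) = r - 1"
      using card_Kr Kr_zero by (simp add: card_Diff_singleton)
    finally show ?thesis using r_ge_3 by simp
  qed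
  also have "\<dots> \<le> (\<Sum>d\<in>Kr. (cmod (f d))\<^sup>2)"
    by (intro sum_mono2) auto
  finally have "(real r - 1) * (cmod (f c))\<^sup>2 \<le> (real r - 1) * B" using total by simp
  moreover have "real r - 1 > 0" using r_ge_3 by linarith
  ultimately have "(cmod (f c))\<^sup>2 \<le> B" by (simp only: mult_le_cancel_left_pos)
  then show ?thesis by (rule real_le_rsqrt)
qed

section \<open>Second moments of the two sums attached to a nontrivial character\<close>

context
  fixes \<xi>
  assumes chi: "\<xi> \<in> mult_chars F" and nontriv: "\<xi> \<noteq> triv_char"
begin

definition "fiber_sum y = (\<Sum>x\<in>Fstar. of_bool (Tr x = y) * \<xi> x)"

definition "twisted_sum c = (\<Sum>x\<in>Fstar. \<xi> x * of_real (eta (Tr x \<oplus> c)))"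

text \<open>Elements are grouped by their trace, which always lies in \<open>Kr\<close>. Applied
  with f constant, with f the conjugate of \<open>fiber_sum\<close>, and with f a translate of
  \<open>eta\<close>.\<close>

lemma sum_by_fibers:
  "(\<Sum>x\<in>Fstar. \<xi> x * f (Tr x)) = (\<Sum>y\<in>Kr. fiber_sum y * f y)"
proof -
  have "(\<Sum>y\<in>Kr. fiber_sum y * f y) = (\<Sum>y\<in>Kr. \<Sum>x\<in>Fstar. of_bool (Tr x = y) * \<xi> x * f y)"
    by (simp add: fiber_sum_def sum_distrib_right)
  also have "\<dots> = (\<Sum>x\<in>Fstar. \<Sum>y\<in>Kr. of_bool (Tr x = y) * \<xi> x * f y)"
    by (rule sum.swap)
  also have "\<dots> = (\<Sum>x\<in>Fstar. \<xi> x * f (Tr x))"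
  proof (rule sum.cong)
    fix x assume x: "x \<in> Fstar"
    have "(\<Sum>y\<in>Kr. of_bool (Tr x = y) * \<xi> x * f y)
        = (\<Sum>y\<in>Kr. if Tr x = y then \<xi> x * f y else 0)"
      by (intro sum.cong) auto
    also have "\<dots> = \<xi> x * f (Tr x)" using trace_in_Kr[of x] x by simp
    finally show "(\<Sum>y\<in>Kr. of_bool (Tr x = y) * \<xi> x * f y) = \<xi> x * f (Tr x)" .
  qed simp
  finally show ?thesis by simp
qed

lemma fiber_sum_total: "(\<Sum>y\<in>Kr. fiber_sum y) = 0"
  using sum_by_fibers[of "\<lambda>_. 1"] char_sum_zero[OF chi nontriv] by simp

text \<open>The moment sums over pairs of equal trace. Writing the pair as x and u x, its weight
  depends on u alone, so the moment is the sum of the character at u times the count in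
  \<open>card_trace_fixed\<close>. The constant part of that count cancels and only u = 1
  remains.\<close>

lemma fiber_sum_square_total:
  "(\<Sum>y\<in>Kr. (cmod (fiber_sum y))\<^sup>2) = real q - real q / real r"
proof -
  let ?n = "\<lambda>u. card {x \<in> Fstar. Tr (u \<otimes> x) = Tr x}"
  have one: "\<one> \<in> Fstar" by simp
  have "complex_of_real (\<Sum>y\<in>Kr. (cmod (fiber_sum y))\<^sup>2) = (\<Sum>y\<in>Kr. fiber_sum y * cnj (fiber_sum y))"
    by (simp only: of_real_sum complex_norm_square)
  also have "\<dots> = (\<Sum>x\<in>Fstar. \<xi> x * cnj (fiber_sum (Tr x)))"
    by (rule sum_by_fibers[symmetric])
  \<comment> \<open>The conjugation is moved outside so that the inner sum involves the character at
    u itself; that sum turns out to be real, which removes the conjugation at the end.\<close>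
  also have "\<dots> = cnj (\<Sum>x\<in>Fstar. cnj (\<xi> x) * fiber_sum (Tr x))" by simp
  also have "(\<Sum>x\<in>Fstar. cnj (\<xi> x) * fiber_sum (Tr x))
      = (\<Sum>x\<in>Fstar. \<Sum>u\<in>Fstar. of_bool (Tr (u \<otimes> x) = Tr x) * \<xi> u)"
  proof (rule sum.cong)
    fix x assume x: "x \<in> Fstar"
    have "fiber_sum (Tr x) = (\<Sum>u\<in>Fstar. of_bool (Tr (x \<otimes> u) = Tr x) * \<xi> (x \<otimes> u))"
      unfolding fiber_sum_def by (rule sum.reindex_bij_betw[OF bij_mult[OF x], symmetric])
    also have "\<dots> = (\<Sum>u\<in>Fstar. of_bool (Tr (u \<otimes> x) = Tr x) * (\<xi> x * \<xi> u))"
      using x char_mult[OF chi x] m_comm by (intro sum.cong) auto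
    finally have "cnj (\<xi> x) * fiber_sum (Tr x)
        = (\<Sum>u\<in>Fstar. of_bool (Tr (u \<otimes> x) = Tr x) * (\<xi> x * cnj (\<xi> x)) * \<xi> u)"
      by (simp add: sum_distrib_left mult_ac)
    then show "cnj (\<xi> x) * fiber_sum (Tr x) = (\<Sum>u\<in>Fstar. of_bool (Tr (u \<otimes> x) = Tr x) * \<xi> u)"
      using char_cnj[OF chi x] by simp
  qed simp
  also have "\<dots> = (\<Sum>u\<in>Fstar. \<Sum>x\<in>Fstar. of_bool (Tr (u \<otimes> x) = Tr x) * \<xi> u)"
    by (rule sum.swap)
  also have "\<dots> = (\<Sum>u\<in>Fstar. of_real (real (?n u)) * \<xi> u)"
  proof (intro sum.cong refl)
    fix u
    have eq: "Fstar \<inter> {x. Tr (u \<otimes> x) = Tr x} = {x \<in> Fstar. Tr (u \<otimes> x) = Tr x}"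
      by (rule Collect_conj_eq[THEN trans, symmetric]) (simp only: Collect_mem_eq)
    have "(\<Sum>x\<in>Fstar. of_bool (Tr (u \<otimes> x) = Tr x))
        = (of_nat (card (Fstar \<inter> {x. Tr (u \<otimes> x) = Tr x})) :: complex)"
      using fin by (intro sum_of_bool_eq) auto
    then have "(\<Sum>x\<in>Fstar. of_bool (Tr (u \<otimes> x) = Tr x)) = (of_nat (?n u) :: complex)"
      unfolding eq .
    then show "(\<Sum>x\<in>Fstar. of_bool (Tr (u \<otimes> x) = Tr x) * \<xi> u) = of_real (real (?n u)) * \<xi> u"
      by (simp only: sum_distrib_right[symmetric] of_real_of_nat_eq)
  qed
  also have "\<dots> = (\<Sum>u\<in>Fstar. of_real (real q / real r - 1) * \<xi> u
      + of_real (real q - real q / real r) * (if u = \<one> then 1 else 0))"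
  proof (intro sum.cong refl)
    fix u assume "u \<in> Fstar"
    have *: "of_real (B + of_bool (u = \<one>) * C) * \<xi> u
        = of_real B * \<xi> u + of_real C * (if u = \<one> then 1 else 0)" for B C :: real
      by (auto simp: char_one[OF chi] algebra_simps)
    show "of_real (real (?n u)) * \<xi> u = of_real (real q / real r - 1) * \<xi> u
        + of_real (real q - real q / real r) * (if u = \<one> then 1 else 0)"
      unfolding card_trace_fixed[OF \<open>u \<in> Fstar\<close>] by (rule *)
  qed
  also have "\<dots> = of_real (real q / real r - 1) * (\<Sum>u\<in>Fstar. \<xi> u)
      + of_real (real q - real q / real r) * (\<Sum>u\<in>Fstar. if u = \<one> then 1 else 0)"
    by (simp only: sum.distrib sum_distrib_left)
  also have "\<dots> = of_real (real q - real q / real r)"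
    using char_sum_zero[OF chi nontriv] one fin by simp
  finally have "complex_of_real (\<Sum>y\<in>Kr. (cmod (fiber_sum y))\<^sup>2) = of_real (real q - real q / real r)"
    by (simp only: complex_cnj_complex_of_real)
  then show ?thesis by (simp only: of_real_eq_iff)
qed

lemma twisted_sum_fibers:
  "twisted_sum c = (\<Sum>y\<in>Kr. fiber_sum y * of_real (eta (y \<oplus> c)))"
  unfolding twisted_sum_def by (rule sum_by_fibers)

text \<open>By \<open>eta_correlation\<close> the quadratic form in the fibre sums has r on the
  diagonal, minus 1 everywhere. The second part is the squared modulus of their total, which is
  zero, so r times the moment of \<open>fiber_sum\<close> is left.\<close>

lemma twisted_sum_square_total:
  "(\<Sum>c\<in>Kr. (cmod (twisted_sum c))\<^sup>2) = real q * (real r - 1)"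
proof -
  let ?A = fiber_sum
  have "complex_of_real (\<Sum>c\<in>Kr. (cmod (twisted_sum c))\<^sup>2)
      = (\<Sum>c\<in>Kr. twisted_sum c * cnj (twisted_sum c))"
    by (simp only: of_real_sum complex_norm_square)
  also have "\<dots> = (\<Sum>c\<in>Kr. \<Sum>y\<in>Kr. \<Sum>z\<in>Kr.
      ?A y * cnj (?A z) * of_real (eta (y \<oplus> c) * eta (z \<oplus> c)))"
    by (simp add: twisted_sum_fibers sum_product mult_ac)
  also have "\<dots> = (\<Sum>y\<in>Kr. \<Sum>z\<in>Kr. \<Sum>c\<in>Kr.
      ?A y * cnj (?A z) * of_real (eta (y \<oplus> c) * eta (z \<oplus> c)))"
    by (subst sum.swap) (intro sum.cong refl sum.swap)
  also have "\<dots> = (\<Sum>y\<in>Kr. \<Sum>z\<in>Kr. ?A y * cnj (?A z) *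
      of_real (\<Sum>c\<in>Kr. eta (y \<oplus> c) * eta (z \<oplus> c)))"
    by (simp add: sum_distrib_left)
  also have "\<dots> = (\<Sum>y\<in>Kr. \<Sum>z\<in>Kr. (if y = z then of_nat r * (?A y * cnj (?A y)) else 0)
      - ?A y * cnj (?A z))"
    by (intro sum.cong refl) (simp add: eta_correlation algebra_simps)
  also have "\<dots> = (\<Sum>y\<in>Kr. of_nat r * (?A y * cnj (?A y))) - (\<Sum>y\<in>Kr. ?A y) * cnj (\<Sum>y\<in>Kr. ?A y)"
    by (simp add: sum_subtractf sum_product)
  also have "\<dots> = of_real (real r * (\<Sum>y\<in>Kr. (cmod (?A y))\<^sup>2))"
    by (simp only: fiber_sum_total of_real_mult of_real_sum of_real_of_nat_eq complex_norm_square
        sum_distrib_left) simp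
  finally have "(\<Sum>c\<in>Kr. (cmod (twisted_sum c))\<^sup>2) = real r * (\<Sum>y\<in>Kr. (cmod (?A y))\<^sup>2)"
    by (simp only: of_real_eq_iff)
  also have "\<dots> = real q * (real r - 1)"
    unfolding fiber_sum_square_total by (rule real_r_identity)
  finally show ?thesis .
qed

lemma fiber_sum_scale:
  assumes c: "c \<in> Kr - {\<zero>}"
  shows "cmod (fiber_sum c) = cmod (fiber_sum \<one>)"
proof -
  note cF = Kr_Fstar[OF c]
  have "fiber_sum c = (\<Sum>x\<in>Fstar. of_bool (Tr (c \<otimes> x) = c) * \<xi> (c \<otimes> x))"
    unfolding fiber_sum_def by (rule sum.reindex_bij_betw[OF bij_mult[OF cF], symmetric])
  also have "\<dots> = (\<Sum>x\<in>Fstar. of_bool (Tr x = \<one>) * (\<xi> c * \<xi> x))"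
  proof (intro sum.cong refl)
    fix x assume x: "x \<in> Fstar"
    have "Tr (c \<otimes> x) = c \<longleftrightarrow> Tr x = \<one>"
      using m_lcancel[of c "Tr x" \<one>] trace_scale[of c x s] c cF x trace_carrier by simp
    then show "of_bool (Tr (c \<otimes> x) = c) * \<xi> (c \<otimes> x) = of_bool (Tr x = \<one>) * (\<xi> c * \<xi> x)"
      using char_mult[OF chi cF x] by simp
  qed
  also have "\<dots> = \<xi> c * fiber_sum \<one>"
    by (simp add: fiber_sum_def sum_distrib_left mult_ac)
  finally show ?thesis using char_norm[OF chi cF] by (simp add: norm_mult)
qed

lemma twisted_sum_scale:
  assumes c: "c \<in> Kr - {\<zero>}"
  shows "cmod (twisted_sum c) = cmod (twisted_sum \<one>)"
proof -
  note cF = Kr_Fstar[OF c]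
  have "twisted_sum c = (\<Sum>x\<in>Fstar. \<xi> (c \<otimes> x) * of_real (eta (Tr (c \<otimes> x) \<oplus> c)))"
    unfolding twisted_sum_def by (rule sum.reindex_bij_betw[OF bij_mult[OF cF], symmetric])
  also have "\<dots> = (\<Sum>x\<in>Fstar. of_real (eta c) * \<xi> c * (\<xi> x * of_real (eta (Tr x \<oplus> \<one>))))"
  proof (intro sum.cong refl)
    fix x assume x: "x \<in> Fstar"
    have T: "Tr x \<in> Kr" using trace_in_Kr x by simp
    have "Tr (c \<otimes> x) \<oplus> c = c \<otimes> (Tr x \<oplus> \<one>)"
      using trace_scale[of c x s] c cF x Kr_carrier[OF T] by (simp add: r_distr)
    then have "eta (Tr (c \<otimes> x) \<oplus> c) = eta c * eta (Tr x \<oplus> \<one>)"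
      using eta_mult Kr_add[OF T Kr_one] c by simp
    then show "\<xi> (c \<otimes> x) * of_real (eta (Tr (c \<otimes> x) \<oplus> c))
        = of_real (eta c) * \<xi> c * (\<xi> x * of_real (eta (Tr x \<oplus> \<one>)))"
      using char_mult[OF chi cF x] by simp
  qed
  also have "\<dots> = of_real (eta c) * \<xi> c * twisted_sum \<one>"
    by (simp only: twisted_sum_def sum_distrib_left)
  finally show ?thesis
    using char_norm[OF chi cF] eta_values[of c] c by (auto simp: norm_mult)
qed

lemma fiber_sum_bound:
  assumes c: "c \<in> Kr - {\<zero>}"
  shows "cmod (fiber_sum c) \<le> sqrt (real q / real r)"
proof (rule scale_bound[where f = fiber_sum, OF fiber_sum_scale _ c])
  show "(\<Sum>c\<in>Kr. (cmod (fiber_sum c))\<^sup>2) = (real r - 1) * (real q / real r)"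
    unfolding fiber_sum_square_total by (rule real_r_identity)
qed

lemma twisted_sum_bound:
  assumes c: "c \<in> Kr - {\<zero>}"
  shows "cmod (twisted_sum c) \<le> sqrt (real q)"
proof (rule scale_bound[where f = twisted_sum, OF twisted_sum_scale _ c])
  show "(\<Sum>c\<in>Kr. (cmod (twisted_sum c))\<^sup>2) = (real r - 1) * real q"
    using twisted_sum_square_total by (simp add: mult.commute)
qed

end

section \<open>The set D: indicator function, size and character sums\<close>

lemma tr_one_Krs: "tr_one \<in> Kr - {\<zero>}"
  using tr_one_Kr tr_one_nonzero by simp

abbreviation "D \<equiv> Dset F r s"

lemma D_subset: "D \<subseteq> Fstar" by (auto simp: Dset_def)

lemma finite_D [simp]: "finite D" by (rule finite_subset[OF D_subset finite_Fstar])

text \<open>Where Tr x + \<open>tr_one\<close> is nonzero, both values of \<open>eta\<close> are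
  signs and 1 minus their product is 2 or 0. Where it is zero, \<open>eta\<close> vanishes and the
  \<open>of_bool\<close> term cancels the 1. At x = 0 the product is 1, which agrees with D
  excluding 0.\<close>

lemma D_indicator:
  assumes x: "x \<in> carrier F"
  shows "2 * of_bool (x \<in> D)
    = (1::real) - of_bool (Tr x = \<ominus> tr_one) - eta tr_one * eta (Tr x \<oplus> tr_one)"
proof -
  have T: "Tr x \<in> Kr" using trace_in_Kr x by simp
  note Tc = Kr_carrier[OF T] and oc = Kr_carrier[OF tr_one_Kr]
  have sum: "Tr (x \<oplus> \<one>) = Tr x \<oplus> tr_one" using trace_add[of x \<one> s] x trace_one by simp
  have zero: "Tr x \<oplus> tr_one = \<zero> \<longleftrightarrow> Tr x = \<ominus> tr_one"
    using sum_zero_eq_neg[OF Tc oc] l_neg[OF oc] by metis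
  have memD: "x \<in> D \<longleftrightarrow> x \<noteq> \<zero> \<and> eta (Tr x \<oplus> tr_one) = - eta tr_one"
    using x sum by (auto simp: Dset_def tr_one_def)
  have e1: "eta tr_one = 1 \<or> eta tr_one = -1" using eta_values tr_one_Krs by simp
  have "x = \<zero> \<Longrightarrow> Tr x = \<zero>"
    using trace_scale[OF Kr_zero, of \<one> s] trace_carrier by simp
  then have x0: "x = \<zero> \<Longrightarrow> Tr x \<oplus> tr_one = tr_one" using oc by simp
  show ?thesis
  proof (cases "Tr x = \<ominus> tr_one")
    case True
    then have "Tr x \<oplus> tr_one = \<zero>" using zero by simp
    then show ?thesis using True memD e1 by auto
  next
    case False
    then have "eta (Tr x \<oplus> tr_one) = 1 \<or> eta (Tr x \<oplus> tr_one) = -1"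
      using eta_values Kr_add[OF T tr_one_Kr] zero by simp
    then show ?thesis using False memD e1 x0 by auto
  qed
qed

text \<open>The indicator depends on x only through its trace, and all fibres have q/r elements.
  Over the subfield the constant gives r, the single value -\<open>tr_one\<close> takes off 1, and
  the translate of \<open>eta\<close> sums to 0.\<close>

lemma card_D: "real (card D) = real q * (real r - 1) / (2 * real r)"
proof -
  have fib: "(\<Sum>x\<in>carrier F. f (Tr x)) = real q / real r * (\<Sum>y\<in>Kr. f y)" for f :: "'a \<Rightarrow> real"
  proof -
    have "(\<Sum>x\<in>carrier F. f (Tr x)) = (\<Sum>y\<in>Kr. \<Sum>x\<in>{x \<in> carrier F. Tr x = y}. f (Tr x))"
      using fin trace_in_Kr by (intro sum.group[symmetric]) auto
    also have "\<dots> = (\<Sum>y\<in>Kr. real (q div r) * f y)"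
      by (intro sum.cong) (auto simp: trace_fiber)
    also have "real (q div r) = real q / real r"
      using q_eq by (metis dvd_triv_left real_of_nat_div)
    finally show ?thesis by (simp add: sum_distrib_left)
  qed
  have m: "\<ominus> tr_one \<in> Kr" using Kr_minus tr_one_Kr by simp
  have bij: "bij_betw (\<lambda>c. tr_one \<oplus> c) Kr Kr"
  proof (rule bij_betwI[where g = "\<lambda>c. \<ominus> tr_one \<oplus> c"])
    show "(\<oplus>) tr_one \<in> Kr \<rightarrow> Kr" "(\<oplus>) (\<ominus> tr_one) \<in> Kr \<rightarrow> Kr"
      using tr_one_Kr m Kr_add by auto
  qed (use Kr_carrier tr_one_Kr in \<open>auto simp: r_neg1 r_neg2\<close>)
  have e0: "(\<Sum>y\<in>Kr. eta (y \<oplus> tr_one)) = 0"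
  proof -
    have "(\<Sum>y\<in>Kr. eta (y \<oplus> tr_one)) = (\<Sum>y\<in>Kr. eta (tr_one \<oplus> y))"
      using Kr_carrier tr_one_Kr by (intro sum.cong) (auto simp: a_comm)
    then show ?thesis using sum.reindex_bij_betw[OF bij, of eta] eta_sum by simp
  qed
  have "2 * real (card D) = (\<Sum>x\<in>carrier F. 2 * of_bool (x \<in> D))"
  proof -
    have "carrier F \<inter> {x. x \<in> D} = D" using D_subset by blast
    then show ?thesis using fin by (simp add: sum_of_bool_eq sum_distrib_left[symmetric])
  qed
  also have "\<dots> = (\<Sum>x\<in>carrier F. 1 - of_bool (Tr x = \<ominus> tr_one) - eta tr_one * eta (Tr x \<oplus> tr_one))"
    by (intro sum.cong D_indicator refl)
  also have "\<dots> = real q / real r *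
      (\<Sum>y\<in>Kr. 1 - of_bool (y = \<ominus> tr_one) - eta tr_one * eta (y \<oplus> tr_one))"
    by (rule fib)
  also have "(\<Sum>y\<in>Kr. 1 - of_bool (y = \<ominus> tr_one) - eta tr_one * eta (y \<oplus> tr_one)) = real r - 1"
    using m e0 card_Kr by (simp add: sum_subtractf sum_distrib_left[symmetric] of_bool_def)
  finally show ?thesis by simp
qed

lemma char_sum_D_bound:
  assumes chi: "\<xi> \<in> mult_chars F" "\<xi> \<noteq> triv_char"
  shows "cmod (\<Sum>x\<in>D. \<xi> x) \<le> (sqrt (real q) + sqrt (real q / real r)) / 2"
proof -
  let ?A = "fiber_sum \<xi> (\<ominus> tr_one)" and ?V = "twisted_sum \<xi> tr_one"
  have "2 * (\<Sum>x\<in>D. \<xi> x) = (\<Sum>x\<in>Fstar. of_real (2 * of_bool (x \<in> D)) * \<xi> x)"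
  proof -
    have "(\<Sum>x\<in>Fstar. of_bool (x \<in> D) * \<xi> x) = (\<Sum>x\<in>D. of_bool (x \<in> D) * \<xi> x)"
      by (rule sum.mono_neutral_right[OF finite_Fstar D_subset]) auto
    also have "\<dots> = (\<Sum>x\<in>D. \<xi> x)" by (intro sum.cong) auto
    finally have "2 * (\<Sum>x\<in>D. \<xi> x) = 2 * (\<Sum>x\<in>Fstar. of_bool (x \<in> D) * \<xi> x)"
      by (simp only:)
    also have "\<dots> = (\<Sum>x\<in>Fstar. 2 * (of_bool (x \<in> D) * \<xi> x))"
      by (rule sum_distrib_left)
    also have "\<dots> = (\<Sum>x\<in>Fstar. of_real (2 * of_bool (x \<in> D)) * \<xi> x)"
      by (intro sum.cong) (auto simp: of_bool_def)
    finally show ?thesis .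
  qed
  also have "\<dots> = (\<Sum>x\<in>Fstar. of_real (1 - of_bool (Tr x = \<ominus> tr_one)
      - eta tr_one * eta (Tr x \<oplus> tr_one)) * \<xi> x)"
    by (intro sum.cong refl) (subst D_indicator, auto)
  also have "\<dots> = (\<Sum>x\<in>Fstar. \<xi> x) - ?A - of_real (eta tr_one) * ?V"
    unfolding fiber_sum_def[OF chi] twisted_sum_def[OF chi]
    by (simp add: algebra_simps sum_subtractf sum.distrib sum_distrib_left of_bool_def cong: if_cong)
      (simp add: if_distrib cong: if_cong)
  \<comment> \<open>The constant term of the indicator contributes the full character sum, which
    vanishes.\<close>
  finally have "2 * (\<Sum>x\<in>D. \<xi> x) = - ?A - of_real (eta tr_one) * ?V"
    using char_sum_zero[OF chi] by simp
  then have "2 * cmod (\<Sum>x\<in>D. \<xi> x) = cmod (- ?A - of_real (eta tr_one) * ?V)"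
    by (metis norm_mult norm_numeral)
  also have "\<dots> \<le> cmod ?A + cmod (of_real (eta tr_one) * ?V)"
    by (metis norm_minus_cancel norm_triangle_ineq4)
  also have "cmod (of_real (eta tr_one) * ?V) = cmod ?V"
    using eta_values[of tr_one] tr_one_Krs by (auto simp: norm_mult)
  also have "cmod ?A + cmod ?V \<le> sqrt (real q / real r) + sqrt (real q)"
  proof (intro add_mono fiber_sum_bound[OF chi] twisted_sum_bound[OF chi] tr_one_Krs)
    show "\<ominus> tr_one \<in> Kr - {\<zero>}"
      using Kr_minus[OF tr_one_Kr] tr_one_nonzero Kr_carrier[OF tr_one_Kr]
      by (metis Diff_iff minus_minus minus_zero singletonD)
  qed
  finally show ?thesis by simp
qed

subsection \<open>Orthogonality of characters and the Welch bound\<close>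

lemma gen_pow_Fstar: "gen [^] (i::nat) \<in> Fstar"
  using gen_pow_nonzero by simp

lemma Fstar_gen:
  assumes "x \<in> Fstar" obtains i :: nat where "x = gen [^] i"
  using assms gen_gen by blast

lemma char_eqI:
  assumes "\<phi> \<in> mult_chars F" "\<psi> \<in> mult_chars F" "\<phi> gen = \<psi> gen"
  shows "\<phi> = \<psi>"
proof
  fix x
  show "\<phi> x = \<psi> x"
  proof (cases "x \<in> Fstar")
    case True
    then obtain i :: nat where "x = gen [^] i" by (rule Fstar_gen)
    then show ?thesis using char_pow[OF assms(1) gen_in] char_pow[OF assms(2) gen_in] assms(3) by simp
  next
    case False
    then show ?thesis using char_outside[OF assms(1)] char_outside[OF assms(2)] by metis
  qed
qed

text \<open>A character is determined by its value at the generator, and that value is a (q - 1)-th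
  root of unity.\<close>

lemma finite_chars: "finite (mult_chars F)"
proof (rule inj_on_finite)
  show "inj_on (\<lambda>\<phi>. \<phi> gen) (mult_chars F)" using char_eqI by (auto intro!: inj_onI)
  show "(\<lambda>\<phi>. \<phi> gen) ` mult_chars F \<subseteq> {z. z ^ (q - 1) = 1}"
  proof (intro image_subsetI CollectI)
    fix \<phi> assume phi: "\<phi> \<in> mult_chars F"
    show "\<phi> gen ^ (q - 1) = 1"
      unfolding char_pow[OF phi gen_in, symmetric] Fstar_pow_order[OF gen_in]
      by (rule char_one[OF phi])
  qed
  show "finite {z :: complex. z ^ (q - 1) = 1}"
    using q_gt_2 by (intro finite_roots_unity) linarith
qed

text \<open>The generator is sent to a primitive (q - 1)-th root of unity. Both have the same order,
  so equal powers of one match equal powers of the other. This character separates any u from 1 in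
  the dual orthogonality relation.\<close>

lemma faithful_char:
  obtains \<phi> where "\<phi> \<in> mult_chars F" "\<And>x. x \<in> Fstar \<Longrightarrow> \<phi> x = 1 \<Longrightarrow> x = \<one>"
proof -
  define z where "z = exp (2 * of_real pi * \<i> * of_nat 1 / of_nat (q - 1))"
  have z: "z ^ n = 1 \<longleftrightarrow> (q - 1) dvd n" for n
  proof -
    have "z ^ n = exp (2 * of_real pi * \<i> * of_nat n / of_nat (q - 1))"
      unfolding z_def exp_of_nat_mult[symmetric] by (simp only: mult_ac times_divide_eq_right of_nat_1 mult_1_left mult_1_right)
    then show ?thesis using complex_root_unity_eq_1[of "q - 1" n] q_gt_2 by simp
  qed
  have wd: "z ^ i = z ^ j" if "gen [^] i = gen [^] j" for i j :: nat
  proof -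
    have *: "z ^ i = z ^ j" if le: "i \<le> j" and e: "gen [^] i = gen [^] j" for i j :: nat
    proof -
      have "gen [^] (j - i) = \<one>" using pow_eq_imp_diff_one[OF gen_in le e] .
      then have "z ^ (j - i) = 1" using z gen_pow_eq_one_iff by simp
      then show ?thesis using le power_add[of z i "j - i"] by simp
    qed
    show ?thesis
    proof (cases "i \<le> j")
      case True
      then show ?thesis using that by (rule *)
    next
      case False
      then have "j \<le> i" by simp
      then show ?thesis using *[OF _ that[symmetric]] by metis
    qed
  qed
  \<comment> \<open>The exponent is chosen arbitrarily; by \<open>wd\<close> the value does not
    depend on the choice.\<close>
  define \<phi> where "\<phi> x = (if x \<in> Fstar then z ^ (SOME i. x = gen [^] i) else 0)" for x
  have phi_gen: "\<phi> (gen [^] i) = z ^ i" for i :: nat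
  proof -
    have "\<phi> (gen [^] i) = z ^ (SOME j. gen [^] i = gen [^] j)"
      unfolding \<phi>_def using gen_pow_Fstar[of i] by (rule if_P)
    also have "gen [^] i = gen [^] (SOME j. gen [^] i = gen [^] (j::nat))"
      by (rule someI) (rule refl)
    then have "z ^ (SOME j. gen [^] i = gen [^] j) = z ^ i" by (rule wd[symmetric])
    finally show ?thesis .
  qed
  have "z \<noteq> 0" by (simp add: z_def)
  have "\<phi> \<in> mult_chars F"
    unfolding mult_chars_def
  proof (intro CollectI conjI ballI allI impI)
    fix x assume "x \<in> Fstar"
    then obtain i :: nat where i: "x = gen [^] i" by (rule Fstar_gen)
    show "\<phi> x \<noteq> 0" using \<open>z \<noteq> 0\<close> i phi_gen by simp
    fix y assume "y \<in> Fstar"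
    then obtain j :: nat where j: "y = gen [^] j" by (rule Fstar_gen)
    have "x \<otimes> y = gen [^] (i + j)" using i j by (simp add: nat_pow_mult)
    then show "\<phi> (x \<otimes> y) = \<phi> x * \<phi> y" using i j phi_gen by (simp add: power_add)
  next
    fix x assume "x \<notin> Fstar"
    then show "\<phi> x = 0" by (simp only: \<phi>_def if_False)
  qed
  moreover have "x = \<one>" if x: "x \<in> Fstar" "\<phi> x = 1" for x
  proof -
    obtain i :: nat where i: "x = gen [^] i" using x(1) by (rule Fstar_gen)
    then show ?thesis using x(2) phi_gen z gen_pow_eq_one_iff by simp
  qed
  ultimately show thesis using that by blast
qed

lemma char_mult_char:
  assumes "\<phi> \<in> mult_chars F" "\<psi> \<in> mult_chars F"
  shows "(\<lambda>x. \<phi> x * \<psi> x) \<in> mult_chars F"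
  using assms unfolding mult_chars_def by auto

lemma char_cnj_eq_inv:
  assumes phi: "\<phi> \<in> mult_chars F" and x: "x \<in> Fstar"
  shows "cnj (\<phi> x) = \<phi> (inv x)"
proof -
  have "\<phi> x * \<phi> (inv x) = \<phi> x * cnj (\<phi> x)"
    using char_mult[OF phi x Fstar_inv[OF x]] Fstar_r_inv[OF x] char_one[OF phi] char_cnj[OF phi x] by simp
  then show ?thesis using char_nonzero[OF phi x] by simp
qed

text \<open>Multiplication by a faithful character permutes the finite set of characters, while it
  multiplies the sum by a value other than 1.\<close>

lemma dual_sum_zero:
  assumes u: "u \<in> Fstar" "u \<noteq> \<one>"
  shows "(\<Sum>\<phi>\<in>mult_chars F. \<phi> u) = 0"
proof -
  obtain \<psi> where psi: "\<psi> \<in> mult_chars F" "\<And>x. x \<in> Fstar \<Longrightarrow> \<psi> x = 1 \<Longrightarrow> x = \<one>"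
    by (rule faithful_char) blast
  have psi_u: "\<psi> u \<noteq> 1" using psi(2) u by blast
  let ?m = "\<lambda>\<phi> x. \<psi> x * \<phi> x"
  have inj: "inj_on ?m (mult_chars F)"
  proof (rule inj_onI)
    fix a b assume ab: "a \<in> mult_chars F" "b \<in> mult_chars F" "?m a = ?m b"
    then have "\<psi> gen * a gen = \<psi> gen * b gen" by metis
    then have "a gen = b gen" using char_nonzero[OF psi(1) gen_in] by simp
    then show "a = b" using char_eqI ab by blast
  qed
  have "?m ` mult_chars F \<subseteq> mult_chars F" using char_mult_char[OF psi(1)] by blast
  then have bij: "bij_betw ?m (mult_chars F) (mult_chars F)"
    using inj finite_chars by (simp add: bij_betw_def endo_inj_surj)
  have "(\<Sum>\<phi>\<in>mult_chars F. \<phi> u) = (\<Sum>\<phi>\<in>mult_chars F. \<psi> u * \<phi> u)"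
    by (rule sum.reindex_bij_betw[OF bij, symmetric])
  also have "\<dots> = \<psi> u * (\<Sum>\<phi>\<in>mult_chars F. \<phi> u)" by (rule sum_distrib_left[symmetric])
  finally show ?thesis using psi_u by simp
qed

text \<open>Both orthogonality relations evaluate the sum of all \<open>\<phi> x\<close>, which gives the number of
  characters without classifying them.\<close>
lemma card_chars: "card (mult_chars F) = q - 1"
proof -
  have one: "\<one> \<in> Fstar" by simp
  have "of_nat (q - 1) = (\<Sum>x\<in>Fstar. triv_char x)"
    using card_Fstar by (simp add: triv_char_def)
  also have "\<dots> = (\<Sum>\<phi>\<in>mult_chars F. \<Sum>x\<in>Fstar. \<phi> x)"
    using char_sum_zero by (subst sum.remove[OF finite_chars triv_char_mem]) simp
  also have "\<dots> = (\<Sum>x\<in>Fstar. \<Sum>\<phi>\<in>mult_chars F. \<phi> x)" by (rule sum.swap)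
  also have "\<dots> = (\<Sum>\<phi>\<in>mult_chars F. \<phi> \<one>)"
    using dual_sum_zero by (subst sum.remove[OF finite_Fstar one]) simp
  also have "\<dots> = (\<Sum>\<phi>\<in>mult_chars F. 1)" by (intro sum.cong refl char_one)
  also have "\<dots> = of_nat (card (mult_chars F))" by simp
  finally show ?thesis by (simp only: of_nat_eq_iff)
qed

text \<open>Expanding the square gives, for each pair x, y in D, the sum of all characters at x/y,
  which is q - 1 on the diagonal and 0 elsewhere.\<close>

lemma parseval_D:
  "(\<Sum>\<phi>\<in>mult_chars F. (cmod (\<Sum>x\<in>D. \<phi> x))\<^sup>2) = (real q - 1) * real (card D)"
proof -
  have inner: "(\<Sum>\<phi>\<in>mult_chars F. \<phi> x * cnj (\<phi> y)) = (if x = y then of_nat (q - 1) else 0)"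
    if xy: "x \<in> D" "y \<in> D" for x y
  proof -
    have F: "x \<in> Fstar" "y \<in> Fstar" using xy D_subset by auto
    have "(\<Sum>\<phi>\<in>mult_chars F. \<phi> x * cnj (\<phi> y)) = (\<Sum>\<phi>\<in>mult_chars F. \<phi> (x \<otimes> inv y))"
      using char_mult[OF _ F(1) Fstar_inv[OF F(2)]] char_cnj_eq_inv[OF _ F(2)]
      by (intro sum.cong refl) simp
    also have "\<dots> = (if x = y then of_nat (q - 1) else 0)"
    proof (cases "x = y")
      case True
      have "(\<Sum>\<phi>\<in>mult_chars F. \<phi> (x \<otimes> inv y)) = (\<Sum>\<phi>\<in>mult_chars F. 1)"
        unfolding True Fstar_r_inv[OF F(2)] by (intro sum.cong refl char_one)
      then show ?thesis using True card_chars by simp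
    next
      case False
      have "x \<otimes> inv y \<noteq> \<one>"
      proof
        assume "x \<otimes> inv y = \<one>"
        then have "x \<otimes> inv y = y \<otimes> inv y" using Fstar_r_inv[OF F(2)] by simp
        then show False using False F Fstar_inv[OF F(2)] m_rcancel[of "inv y" x y] by auto
      qed
      then show ?thesis using False dual_sum_zero[OF Fstar_mult[OF F(1) Fstar_inv[OF F(2)]]] by simp
    qed
    finally show ?thesis .
  qed
  have "complex_of_real (\<Sum>\<phi>\<in>mult_chars F. (cmod (\<Sum>x\<in>D. \<phi> x))\<^sup>2)
      = (\<Sum>\<phi>\<in>mult_chars F. \<Sum>x\<in>D. \<Sum>y\<in>D. \<phi> x * cnj (\<phi> y))"
    by (simp only: of_real_sum complex_norm_square sum_product cnj_sum)
  also have "\<dots> = (\<Sum>x\<in>D. \<Sum>y\<in>D. \<Sum>\<phi>\<in>mult_chars F. \<phi> x * cnj (\<phi> y))"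
    by (subst sum.swap) (intro sum.cong refl sum.swap)
  also have "\<dots> = (\<Sum>x\<in>D. \<Sum>y\<in>D. if x = y then of_nat (q - 1) else 0)"
    by (intro sum.cong refl inner)
  also have "\<dots> = of_nat (card D) * of_nat (q - 1)"
    by (simp add: finite_D)
  also have "\<dots> = complex_of_real (real (q - 1) * real (card D))" by simp
  finally have "(\<Sum>\<phi>\<in>mult_chars F. (cmod (\<Sum>x\<in>D. \<phi> x))\<^sup>2) = real (q - 1) * real (card D)"
    by (simp only: of_real_eq_iff)
  moreover have "real (q - 1) = real q - 1" using q_gt_2 by (intro of_nat_diff[THEN trans]) auto
  ultimately show ?thesis by simp
qed

lemma card_D_pos: "real (card D) > 0"
proof -
  have *: "x * (y - 1) / (2 * y) > 0" if "y > 1" "x > 0" for x y :: real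
    using that by simp
  have "real r > 1" "real q > 0" using r_ge_3 q_gt_2 by linarith+
  then show ?thesis unfolding card_D by (intro *)
qed

text \<open>D has density (r - 1)/(2r) in F, just below one half; the comparison in
  \<open>welch_ge\<close> rests on this.\<close>

lemma card_D_le: "2 * real (card D) \<le> real q"
proof -
  have *: "2 * (x * (y - 1) / (2 * y)) \<le> x" if "y > 1" "x > 0" for x y :: real
    using that by (simp add: field_simps)
  have "real r > 1" "real q > 0" using r_ge_3 q_gt_2 by linarith+
  then show ?thesis unfolding card_D by (rule *)
qed

section \<open>Upper and lower bounds for the maximal correlation\<close>

lemma code_inner_eq:
  "code_inner D \<phi> \<psi> = (\<Sum>x\<in>D. \<phi> x * cnj (\<psi> x)) / of_nat (card D)"
proof -
  have "codeword D \<phi> x * cnj (codeword D \<psi> x) = \<phi> x * cnj (\<psi> x) / of_nat (card D)" for x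
  proof -
    have "complex_of_real (sqrt (real (card D))) * complex_of_real (sqrt (real (card D))) = of_nat (card D)"
      by (simp flip: of_real_mult)
    then show ?thesis by (simp add: codeword_def)
  qed
  then show ?thesis by (simp add: code_inner_def sum_divide_distrib)
qed

abbreviation "I \<equiv> I_max D (mult_chars F)"

abbreviation "inner_moduli \<equiv> {cmod (code_inner D \<phi> \<psi>) | \<phi> \<psi>.
  \<phi> \<in> mult_chars F \<and> \<psi> \<in> mult_chars F \<and> \<phi> \<noteq> \<psi>}"

lemma finite_moduli: "finite inner_moduli"
proof (rule finite_subset)
  show "inner_moduli \<subseteq> (\<lambda>(\<phi>, \<psi>). cmod (code_inner D \<phi> \<psi>)) ` (mult_chars F \<times> mult_chars F)"
    by auto
qed (use finite_chars in auto)

text \<open>A character paired with the trivial one gives an admissible inner product, equal to its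
  sum over D divided by the size of D.\<close>

lemma I_ge_char_sum:
  assumes "\<phi> \<in> mult_chars F" "\<phi> \<noteq> triv_char"
  shows "cmod (\<Sum>x\<in>D. \<phi> x) \<le> real (card D) * I"
proof -
  have "(\<Sum>x\<in>D. \<phi> x * cnj (triv_char x)) = (\<Sum>x\<in>D. \<phi> x)"
    using D_subset by (intro sum.cong) (auto simp: triv_char_def)
  then have "cmod (\<Sum>x\<in>D. \<phi> x) / real (card D) = cmod (code_inner D \<phi> triv_char)"
    by (simp add: code_inner_eq norm_divide)
  also have "\<dots> \<le> I"
    unfolding I_max_def using assms triv_char_mem by (intro Max_ge finite_moduli) blast
  finally show ?thesis using card_D_pos by (simp add: divide_le_eq mult.commute)
qed

lemma I_max_le: "I \<le> 1 / (sqrt (real q) * (1 - 1 / sqrt (real r)))"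
  unfolding I_max_def
proof (rule Max.boundedI[OF finite_moduli])
  \<comment> \<open>A maximum needs a nonempty set: as q > 2, there is a second character to pair
    with the trivial one.\<close>
  have "card (mult_chars F) \<ge> 2" using card_chars q_gt_2 by simp
  then have "mult_chars F \<noteq> {triv_char}" by auto
  then show "inner_moduli \<noteq> {}" using triv_char_mem by blast
next
  fix a assume "a \<in> inner_moduli"
  then obtain \<phi> \<psi> where ph: "\<phi> \<in> mult_chars F" "\<psi> \<in> mult_chars F" "\<phi> \<noteq> \<psi>"
    and a: "a = cmod (code_inner D \<phi> \<psi>)" by blast
  let ?x = "\<lambda>x. \<phi> x * cnj (\<psi> x)"
  have "?x \<noteq> triv_char"
  proof
    assume "?x = triv_char"
    then have "\<phi> gen * cnj (\<psi> gen) = \<psi> gen * cnj (\<psi> gen)"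
      using gen_in char_cnj[OF ph(2) gen_in] by (metis triv_char_def)
    then have "\<phi> gen = \<psi> gen" using char_nonzero[OF ph(2) gen_in] by simp
    then show False using char_eqI ph by blast
  qed
  then have "cmod (\<Sum>x\<in>D. ?x x) \<le> (sqrt (real q) + sqrt (real q / real r)) / 2"
    using char_sum_D_bound char_prod_cnj ph by blast
  then have "a \<le> ((sqrt (real q) + sqrt (real q / real r)) / 2) / real (card D)"
    unfolding a code_inner_eq norm_divide norm_of_nat using card_D_pos
    by (intro divide_right_mono) linarith+
  also have "\<dots> = 1 / (sqrt (real q) * (1 - 1 / sqrt (real r)))"
  proof -
    have *: "((sqrt x + sqrt (x / y)) / 2) / (x * (y - 1) / (2 * y)) = 1 / (sqrt x * (1 - 1 / sqrt y))"
      if xy: "x > 0" "y > 1" for x y :: real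
    proof -
      \<comment> \<open>With square roots as variables the numerator contains w + 1, which cancels
        against y - 1 = (w - 1)(w + 1).\<close>
      define v w where "v = sqrt x" and "w = sqrt y"
      have v: "v > 0" "x = v * v" and w: "w > 1" "y = w * w"
        using xy by (auto simp: v_def w_def)
      have s: "sqrt (x / y) = v / w" by (simp add: real_sqrt_divide v_def w_def)
      have f: "w * w - 1 = (w - 1) * (w + 1)" by (simp add: algebra_simps)
      have "((v + v / w) / 2) / (v * v * ((w - 1) * (w + 1)) / (2 * (w * w))) = 1 / (v * (1 - 1 / w))"
        using v w by (simp add: divide_simps) (simp add: algebra_simps)
      then show ?thesis unfolding s v_def[symmetric] w_def[symmetric] unfolding v(2) w(2) f .
    qed
    have "real r > 1" "real q > 0" using r_ge_3 q_gt_2 by linarith+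
    then show ?thesis unfolding card_D by (intro *)
  qed
  finally show "a \<le> 1 / (sqrt (real q) * (1 - 1 / sqrt (real r)))" .
qed

abbreviation "W \<equiv> welch_bound (card (carrier F) - 1) (card D)"

text \<open>The Welch bound is taken at N = q - 1, hence the shifts by 1 and 2.\<close>

lemma welch_eq: "W = sqrt ((real q - 1 - real (card D)) / ((real q - 2) * real (card D)))"
proof -
  have "real (card (carrier F) - 1) = real q - 1"
    using card_F q_gt_2 by (subst of_nat_diff) auto
  then show ?thesis by (simp add: welch_bound_def)
qed

lemma welch_ge: "1 / sqrt (real q) \<le> W"
proof -
  have q: "real q > 2" using q_gt_2 by linarith
  have *: "1 / x \<le> (x - 1 - k) / ((x - 2) * k)" if "x > 2" "k > 0" "2 * k \<le> x" for x k :: real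
  proof -
    \<comment> \<open>After clearing denominators the difference factors, and its sign is decided by
      2k <= x.\<close>
    have "x * (x - 1 - k) - (x - 2) * k = (x - 1) * (x - 2 * k)" by (simp add: algebra_simps)
    also have "\<dots> \<ge> 0" using that by simp
    finally show ?thesis using that by (simp add: divide_simps mult.commute)
  qed
  have "sqrt (1 / real q) \<le> W"
    unfolding welch_eq by (intro real_sqrt_le_mono * q card_D_pos card_D_le)
  then show ?thesis by (simp only: real_sqrt_divide real_sqrt_one)
qed

text \<open>Of the Parseval total (q - 1) K, the trivial character accounts for K^2 and each of the
  other q - 2 characters for at most (K I)^2. Solving for I^2 gives the square of the Welch
  bound.\<close>

lemma welch_le_I_max: "W \<le> I"
proof -
  let ?K = "real (card D)" and ?S = "\<lambda>\<phi>. cmod (\<Sum>x\<in>D. \<phi> x)"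
  have q: "real q > 2" using q_gt_2 by linarith
  have c: "card (mult_chars F - {triv_char}) = q - 2"
    using card_chars triv_char_mem by (simp add: card_Diff_singleton)
  have "?S triv_char = ?K"
  proof -
    have "(\<Sum>x\<in>D. triv_char x) = (\<Sum>x\<in>D. 1)"
      using D_subset by (intro sum.cong) (auto simp: triv_char_def)
    then show ?thesis by simp
  qed
  then have "(real q - 1) * ?K = ?K\<^sup>2 + (\<Sum>\<phi>\<in>mult_chars F - {triv_char}. (?S \<phi>)\<^sup>2)"
    using parseval_D sum.remove[OF finite_chars triv_char_mem, of "\<lambda>\<phi>. (?S \<phi>)\<^sup>2"] by simp
  also have "(\<Sum>\<phi>\<in>mult_chars F - {triv_char}. (?S \<phi>)\<^sup>2) \<le> (\<Sum>\<phi>\<in>mult_chars F - {triv_char}. (?K * I)\<^sup>2)"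
    using I_ge_char_sum by (intro sum_mono power_mono) auto
  also have "\<dots> = real (q - 2) * (?K * I)\<^sup>2" using c by simp
  also have "real (q - 2) = real q - 2" using q_gt_2 by (intro of_nat_diff[THEN trans]) auto
  finally have main: "(real q - 1) * ?K \<le> ?K\<^sup>2 + (real q - 2) * (?K * I)\<^sup>2" by simp
  have *: "(x - 1 - k) / ((x - 2) * k) \<le> i\<^sup>2"
    if "x > 2" "k > 0" "(x - 1) * k \<le> k\<^sup>2 + (x - 2) * (k * i)\<^sup>2" for x k i :: real
  proof -
    have "k * (x - 1 - k) \<le> k * (i\<^sup>2 * ((x - 2) * k))"
      using that(3) by (simp add: algebra_simps power2_eq_square)
    then have "x - 1 - k \<le> i\<^sup>2 * ((x - 2) * k)" using that(2) by simp
    then show ?thesis using that by (simp add: divide_le_eq)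
  qed
  have le: "(real q - 1 - ?K) / ((real q - 2) * ?K) \<le> I\<^sup>2" by (rule *[OF q card_D_pos main])
  \<comment> \<open>Needed to pass from the inequality for the square of I to its square
    root.\<close>
  have "I \<ge> 0"
  proof -
    have "card (mult_chars F - {triv_char}) > 0" using c q_gt_2 by simp
    then obtain \<phi> where "\<phi> \<in> mult_chars F - {triv_char}" by (metis all_not_in_conv card.empty less_irrefl)
    then have "0 \<le> ?K * I" using I_ge_char_sum[of \<phi>] norm_ge_zero order_trans by blast
    then show ?thesis using mult_le_cancel_left_pos[OF card_D_pos, of 0 I] by simp
  qed
  then show ?thesis unfolding welch_eq using le by (intro real_le_lsqrt)
qed

text \<open>The factor 1/sqrt q in \<open>I_max_le\<close> is absorbed by \<open>welch_ge\<close>.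
  What remains depends on r alone, so the estimate is uniform in s.\<close>

lemma ratio_bounds:
  "1 \<le> I / W" "I / W \<le> 1 / (1 - inverse (sqrt (real r)))"
proof -
  have "real q > 0" using q_gt_2 by linarith
  then have q: "sqrt (real q) > 0" by (rule real_sqrt_gt_zero)
  have "real r > 1" using r_ge_3 by linarith
  then have w: "inverse (sqrt (real r)) < 1"
    by (intro inverse_less_1_iff[THEN iffD2]) simp
  have "0 < 1 / sqrt (real q)" using q by (intro divide_pos_pos zero_less_one)
  then have W0: "W > 0" using welch_ge by linarith
  then show "1 \<le> I / W" using welch_le_I_max by simp
  have "I \<le> (1 / sqrt (real q)) * (1 / (1 - inverse (sqrt (real r))))"
    using I_max_le by (simp only: inverse_eq_divide times_divide_times_eq mult_1)
  also have "\<dots> \<le> W * (1 / (1 - inverse (sqrt (real r))))"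
    using w by (intro mult_right_mono welch_ge) simp
  finally show "I / W \<le> 1 / (1 - inverse (sqrt (real r)))"
    using W0 by (simp add: divide_le_eq mult.commute)
qed

end

section \<open>The limit as r tends to infinity\<close>

theorem mainTheorem2:
  fixes p t s :: "nat \<Rightarrow> nat"
    and F :: "nat \<Rightarrow> ('a, 'b) ring_scheme"
  assumes prime: "\<And>n. Factorial_Ring.prime (p n)"
    and odd: "\<And>n. odd (p n)"
    and tpos: "\<And>n. t n > 0"
    and spos: "\<And>n. s n > 0"
    and ndvd: "\<And>n. \<not> p n dvd s n"
    and field: "\<And>n. field (F n)"
    and fin: "\<And>n. finite (carrier (F n))"
    and card: "\<And>n. card (carrier (F n)) = (p n ^ t n) ^ s n"
    and r_inf: "filterlim (\<lambda>n. p n ^ t n) at_top sequentially"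
  shows "(\<lambda>n. I_max (Dset (F n) (p n ^ t n) (s n)) (mult_chars (F n))
              / welch_bound (card (carrier (F n)) - 1)
                            (card (Dset (F n) (p n ^ t n) (s n))))
         \<longlonglongrightarrow> 1"
proof -
  have loc: "finite_field_trace (F n) (p n) (t n) (s n)" for n
    using assms by (intro finite_field_trace.intro finite_field_trace_axioms.intro) auto
  have "filterlim (\<lambda>n. real (p n ^ t n)) at_top sequentially"
    by (rule filterlim_compose[OF filterlim_real_sequentially r_inf])
  then have "filterlim (\<lambda>n. sqrt (real (p n ^ t n))) at_top sequentially"
    by (rule filterlim_compose[OF sqrt_at_top])
  then have "(\<lambda>n. inverse (sqrt (real (p n ^ t n)))) \<longlonglongrightarrow> 0"
    by (rule tendsto_inverse_0_at_top)
  then have "(\<lambda>n. 1 / (1 - inverse (sqrt (real (p n ^ t n))))) \<longlonglongrightarrow> 1 / (1 - 0)"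
    by (intro tendsto_intros) auto
  then have upper: "(\<lambda>n. 1 / (1 - inverse (sqrt (real (p n ^ t n))))) \<longlonglongrightarrow> 1" by simp
  show ?thesis
  \<comment> \<open>The ratio is squeezed between 1 and a function of r alone that tends to 1,
    whatever the behaviour of s along the sequence.\<close>
  proof (rule tendsto_sandwich[OF _ _ tendsto_const upper])
    show "\<forall>\<^sub>F n in sequentially. 1 \<le> I_max (Dset (F n) (p n ^ t n) (s n)) (mult_chars (F n))
        / welch_bound (card (carrier (F n)) - 1) (card (Dset (F n) (p n ^ t n) (s n)))"
      using finite_field_trace.ratio_bounds(1)[OF loc] by (intro always_eventually allI)
    show "\<forall>\<^sub>F n in sequentially. I_max (Dset (F n) (p n ^ t n) (s n)) (mult_chars (F n))
        / welch_bound (card (carrier (F n)) - 1) (card (Dset (F n) (p n ^ t n) (s n)))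
        \<le> 1 / (1 - inverse (sqrt (real (p n ^ t n))))"
      using finite_field_trace.ratio_bounds(2)[OF loc] by (intro always_eventually allI)
  qed
qed

end
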